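(* Let $f:\{0,1\}^X\to\{0,1\}$ be a Boolean function on $n$ variables such that $f$ and $\overline{f}$ are represented by smooth, simple structured $d$-DNNFs $\mathcal{D}$ and $\overline{\mathcal{D}}$, respectively, both respecting the same normalized vtree $T$ on $X$. Then there is a vtree $T'$ on $X\cup H$, where $H$ is a set of at most $n-2$ new (auxiliary) variables disjoint from $X$, and an SDD respecting $T'$ that represents $f$ (as a function not depending on the variables in $H$) and has size $\mathcal{O}((|\mathcal{D}|+|\overline{\mathcal{D}}|)^2)$.
   Context: An NNF on a variable set $X$ is a Boolean circuit with fan-in 2 $\wedge$-gates and unbounded fan-in $\vee$-gates whose inputs are literals $x,\overline{x}$ ($x\in X$) or constants $\bot,\top$; its size $|\cdot|$ is its number of gates. $\mathrm{vars}(u)$ is the set of variables occurring in the subcircuit at $u$. A DNNF requires the two children of each $\wedge$-gate to have disjoint variable sets; a $d$-DNNF additionally requires the functions at the children of each $\vee$-gate to be pairwise not simultaneously satisfiable. A vtree for $X$ is a full rooted binary tree with leaves in bijection with $X$; $\mathrm{vars}(v)$ for a vtree node is the set of variables at leaves below $v$. An $\wedge$-gate with children $u_l,u_r$ respects a vtree node $v$ with children $v_l,v_r$ if $\mathrm{vars}(u_l)\subseteq\mathrm{vars}(v_l)$ and $\mathrm{vars}(u_r)\subseteq\mathrm{vars}(v_r)$; a structured $d$-DNNF w.r.t. $T$ is a $d$-DNNF in which every $\wedge$-gate respects some node of $T$. A circuit is smooth if all children of each $\vee$-gate have the same variable set. A structured $d$-DNNF is simple if no edge goes between two $\vee$-gates,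 no $\vee$-gate has a child labeled $\bot$ or $\top$, and the only nodes computing the constant function $\bot$ are nodes labeled $\bot$. A vtree is normalized if for every inner node $v$ with left child $v_\ell$ and right child $v_r$ we have $|\mathrm{vars}(v_\ell)|\le|\mathrm{vars}(v_r)|$. A set of Boolean functions on the same variables is a partition if they are pairwise disjoint (never simultaneously 1), none is the constant $\bot$, and their disjunction is $\top$. An SDD respecting a vtree $T$ is defined inductively: a single node labeled $\bot$ or $\top$ (any $T$); a single node labeled by a literal on a variable of $T$; or an $\vee$-gate whose inputs are $\wedge$-gates $g_1,\dots,g_\ell$, each $g_i$ having inputs $p_i,s_i$, where $v$ is an inner node of $T$ with left child $v_L$ and right child $v_R$, the subcircuits at $p_1,\dots,p_\ell$ are SDDs respecting the subtree of $T$ rooted at $v_L$, those at $s_1,\dots,s_\ell$ are SDDs respecting the subtree rooted at $v_R$, and the functions computed at $p_1,\dots,p_\ell$ form a partition. The size of an SDD is its number of nodes (gates). *)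

theory Defs
  imports Main
begin

text \<open>Variables are natural numbers. A circuit is a list of gates; the children of gate i
  are gates with smaller index (so the circuit is acyclic), and the output gate is the last one.
  The size of a circuit is its number of gates (= length of the list).
  Lit True x is the literal x, Lit False x is the negated literal; Const b is the constant b.\<close>

datatype gate = Lit bool nat | Const bool | And nat nat | Or "nat list"

definition out :: "gate list \<Rightarrow> nat" where
  "out C = length C - 1"

definition wf_circ :: "gate list \<Rightarrow> bool" where
  "wf_circ C \<longleftrightarrow> C \<noteq> [] \<and>
     (\<forall>i<length C. (case C ! i of
         And j k \<Rightarrow> j < i \<and> k < i
       | Or js \<Rightarrow> distinct js \<and> (\<forall>j\<in>set js. j < i)
       | _ \<Rightarrow> True))"

function ev :: "gate list \<Rightarrow> (nat \<Rightarrow> bool) \<Rightarrow> nat \<Rightarrow> bool" where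
  "ev C a i = (if i < length C then (case C ! i of
       Lit b x \<Rightarrow> (a x = b)
     | Const b \<Rightarrow> b
     | And j k \<Rightarrow> (if j < i \<and> k < i then ev C a j \<and> ev C a k else False)
     | Or js \<Rightarrow> (\<exists>j\<in>set (filter (\<lambda>j. j < i) js). ev C a j))
    else False)"
  by pat_completeness auto
termination by (relation "measure (\<lambda>(C, a, i). i)") auto

function gvars :: "gate list \<Rightarrow> nat \<Rightarrow> nat set" where
  "gvars C i = (if i < length C then (case C ! i of
       Lit b x \<Rightarrow> {x}
     | Const b \<Rightarrow> {}
     | And j k \<Rightarrow> (if j < i \<and> k < i then gvars C j \<union> gvars C k else {})
     | Or js \<Rightarrow> (\<Union>j\<in>set (filter (\<lambda>j. j < i) js). gvars C j))
    else {})"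
  by pat_completeness auto
termination by (relation "measure (\<lambda>(C, i). i)") auto

definition nnf_on :: "nat set \<Rightarrow> gate list \<Rightarrow> bool" where
  "nnf_on X C \<longleftrightarrow> wf_circ C \<and> (\<forall>i<length C. \<forall>b x. C ! i = Lit b x \<longrightarrow> x \<in> X)"

definition represents :: "gate list \<Rightarrow> ((nat \<Rightarrow> bool) \<Rightarrow> bool) \<Rightarrow> bool" where
  "represents C f \<longleftrightarrow> (\<forall>a. ev C a (out C) = f a)"

definition decomposable :: "gate list \<Rightarrow> bool" where
  "decomposable C \<longleftrightarrow> (\<forall>i<length C. \<forall>j k. C ! i = And j k \<longrightarrow> gvars C j \<inter> gvars C k = {})"

definition deterministic :: "gate list \<Rightarrow> bool" where
  "deterministic C \<longleftrightarrow> (\<forall>i<length C. \<forall>js. C ! i = Or js \<longrightarrow>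
      (\<forall>j\<in>set js. \<forall>k\<in>set js. j \<noteq> k \<longrightarrow> \<not> (\<exists>a. ev C a j \<and> ev C a k)))"

definition d_DNNF :: "nat set \<Rightarrow> gate list \<Rightarrow> bool" where
  "d_DNNF X C \<longleftrightarrow> nnf_on X C \<and> decomposable C \<and> deterministic C"

definition smooth :: "gate list \<Rightarrow> bool" where
  "smooth C \<longleftrightarrow> (\<forall>i<length C. \<forall>js. C ! i = Or js \<longrightarrow>
      (\<forall>j\<in>set js. \<forall>k\<in>set js. gvars C j = gvars C k))"

datatype vtree = VLeaf nat | VNode vtree vtree

fun vleaves :: "vtree \<Rightarrow> nat list" where
  "vleaves (VLeaf x) = [x]"
| "vleaves (VNode l r) = vleaves l @ vleaves r"

definition vvars :: "vtree \<Rightarrow> nat set" where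
  "vvars v = set (vleaves v)"

fun vsubtrees :: "vtree \<Rightarrow> vtree set" where
  "vsubtrees (VLeaf x) = {VLeaf x}"
| "vsubtrees (VNode l r) = insert (VNode l r) (vsubtrees l \<union> vsubtrees r)"

definition vtree_for :: "vtree \<Rightarrow> nat set \<Rightarrow> bool" where
  "vtree_for T X \<longleftrightarrow> distinct (vleaves T) \<and> set (vleaves T) = X"

definition normalized :: "vtree \<Rightarrow> bool" where
  "normalized T \<longleftrightarrow> (\<forall>l r. VNode l r \<in> vsubtrees T \<longrightarrow> card (vvars l) \<le> card (vvars r))"

definition respects_node :: "gate list \<Rightarrow> nat \<Rightarrow> nat \<Rightarrow> vtree \<Rightarrow> bool" where
  "respects_node C j k v \<longleftrightarrow> (\<exists>vl vr. v = VNode vl vr \<and> gvars C j \<subseteq> vvars vl \<and> gvars C k \<subseteq> vvars vr)"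

definition structured_dDNNF :: "nat set \<Rightarrow> vtree \<Rightarrow> gate list \<Rightarrow> bool" where
  "structured_dDNNF X T C \<longleftrightarrow> vtree_for T X \<and> d_DNNF X C \<and>
     (\<forall>i<length C. \<forall>j k. C ! i = And j k \<longrightarrow> (\<exists>v\<in>vsubtrees T. respects_node C j k v))"

definition simple :: "gate list \<Rightarrow> bool" where
  "simple C \<longleftrightarrow>
     (\<forall>i<length C. \<forall>js. C ! i = Or js \<longrightarrow>
        (\<forall>j\<in>set js. (\<forall>ks. C ! j \<noteq> Or ks) \<and> (\<forall>b. C ! j \<noteq> Const b))) \<and>
     (\<forall>i<length C. (\<forall>a. \<not> ev C a i) \<longrightarrow> C ! i = Const False)"

definition primes_partition :: "gate list \<Rightarrow> (nat \<times> nat) list \<Rightarrow> bool" where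
  "primes_partition C ps \<longleftrightarrow>
     (\<forall>m<length ps. \<forall>m'<length ps. m \<noteq> m' \<longrightarrow> \<not> (\<exists>a. ev C a (fst (ps ! m)) \<and> ev C a (fst (ps ! m')))) \<and>
     (\<forall>m<length ps. \<exists>a. ev C a (fst (ps ! m))) \<and>
     (\<forall>a. \<exists>m<length ps. ev C a (fst (ps ! m)))"

inductive sdd :: "gate list \<Rightarrow> vtree \<Rightarrow> nat \<Rightarrow> bool" where
  sdd_const: "i < length C \<Longrightarrow> C ! i = Const b \<Longrightarrow> sdd C T i"
| sdd_lit: "i < length C \<Longrightarrow> C ! i = Lit b x \<Longrightarrow> x \<in> vvars T \<Longrightarrow> sdd C T i"
| sdd_or: "i < length C \<Longrightarrow> C ! i = Or gs \<Longrightarrow> VNode vl vr \<in> vsubtrees T \<Longrightarrow>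
     length ps = length gs \<Longrightarrow>
     (\<forall>m<length gs. gs ! m < length C \<and> C ! (gs ! m) = And (fst (ps ! m)) (snd (ps ! m))
        \<and> sdd C vl (fst (ps ! m)) \<and> sdd C vr (snd (ps ! m))) \<Longrightarrow>
     primes_partition C ps \<Longrightarrow> sdd C T i"

definition is_SDD :: "vtree \<Rightarrow> gate list \<Rightarrow> bool" where
  "is_SDD T C \<longleftrightarrow> wf_circ C \<and> sdd C T (out C)"

end

theory Submission
  imports Defs
begin

text \<open>
  Join the two circuits and call a literal, or an \<open>\<and>\<close>-gate with two non-constant children, a cell.
  Determinism makes every non-constant gate a disjoint union of cells, so the cells of the two
  outputs together partition the assignments of \<open>X\<close>. Fixing the variables on one side of a vtree
  node turns a partition into cells on both sides of it into a partition into cells on the other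
  side; descending in this way, every gate \<open>u\<close> that is needed becomes a union of members of a
  partition, into cells, of the assignments of the smallest vtree node \<open>v\<close> that contains the
  variables of \<open>u\<close>. Give \<open>v\<close> an auxiliary sibling leaf \<open>h\<close>. Then \<open>u\<close> and its complement are SDDs
  whose primes are the cells and whose subs are constants, placed at \<open>h\<close>; a cell \<open>j \<and> k\<close> is
  \<open>(j \<and> k) \<or> (\<not> j \<and> \<bottom>)\<close>, where the prime \<open>\<not> j\<close> is available because complements are built as well.
  A vtree node with two leaves needs no \<open>h\<close>, since functions of two variables have SDDs of bounded
  size; such a node exists, which saves one of the \<open>n - 1\<close> auxiliary variables.
\<close>

declare ev.simps [simp del] gvars.simps [simp del]

section \<open>Circuits\<close>

lemma wf_And:
  assumes "wf_circ C" "i < length C" "C ! i = And j k"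
  shows "j < i" "k < i"
  using assms by (auto simp: wf_circ_def split: gate.splits)

lemma wf_Or:
  assumes "wf_circ C" "i < length C" "C ! i = Or js"
  shows "distinct js" "\<And>j. j \<in> set js \<Longrightarrow> j < i"
  using assms by (auto simp: wf_circ_def split: gate.splits)

lemma ev_Lit: "i < length C \<Longrightarrow> C ! i = Lit b x \<Longrightarrow> ev C a i = (a x = b)"
  by (subst ev.simps) simp

lemma ev_Const: "i < length C \<Longrightarrow> C ! i = Const b \<Longrightarrow> ev C a i = b"
  by (subst ev.simps) simp

lemma ev_And:
  "wf_circ C \<Longrightarrow> i < length C \<Longrightarrow> C ! i = And j k \<Longrightarrow> ev C a i = (ev C a j \<and> ev C a k)"
  by (subst ev.simps) (simp add: wf_And)

lemma ev_Or:
  "wf_circ C \<Longrightarrow> i < length C \<Longrightarrow> C ! i = Or js \<Longrightarrow> ev C a i = (\<exists>j\<in>set js. ev C a j)"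
  by (subst ev.simps) (auto dest: wf_Or(2))

lemma gvars_Lit: "i < length C \<Longrightarrow> C ! i = Lit b x \<Longrightarrow> gvars C i = {x}"
  by (subst gvars.simps) simp

lemma gvars_Const: "i < length C \<Longrightarrow> C ! i = Const b \<Longrightarrow> gvars C i = {}"
  by (subst gvars.simps) simp

lemma gvars_And:
  "wf_circ C \<Longrightarrow> i < length C \<Longrightarrow> C ! i = And j k \<Longrightarrow> gvars C i = gvars C j \<union> gvars C k"
  by (subst gvars.simps) (simp add: wf_And)

lemma gvars_Or:
  "wf_circ C \<Longrightarrow> i < length C \<Longrightarrow> C ! i = Or js \<Longrightarrow> gvars C i = (\<Union>j\<in>set js. gvars C j)"
  by (subst gvars.simps) (auto dest: wf_Or(2))

lemma ev_cong:
  assumes "wf_circ C" "i < length C" "\<And>x. x \<in> gvars C i \<Longrightarrow> a x = b x"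
  shows "ev C a i = ev C b i"
  using assms(2,3)
proof (induction i rule: less_induct)
  case (less i)
  show ?case
  proof (cases "C ! i")
    case (Lit p x)
    then show ?thesis using less.prems by (simp add: ev_Lit gvars_Lit)
  next
    case (Const p)
    then show ?thesis using less.prems by (simp add: ev_Const)
  next
    case (And j k)
    have lt: "j < i" "k < i" using wf_And[OF assms(1) less.prems(1) And] .
    then have "ev C a j = ev C b j" "ev C a k = ev C b k"
      using less.prems And assms(1) by (simp_all add: less.IH gvars_And)
    then show ?thesis using less.prems And assms(1) by (simp add: ev_And)
  next
    case (Or js)
    have "ev C a j = ev C b j" if "j \<in> set js" for j
    proof (rule less.IH)
      show "j < i" using assms(1) less.prems(1) Or that by (rule wf_Or(2))
      then show "j < length C" using less.prems(1) by simp
      show "a x = b x" if "x \<in> gvars C j" for x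
        using less.prems Or assms(1) \<open>j \<in> set js\<close> that by (auto simp: gvars_Or)
    qed
    then show ?thesis using less.prems Or assms(1) by (simp add: ev_Or)
  qed
qed

lemma gvars_subset:
  assumes "nnf_on X C" "i < length C"
  shows "gvars C i \<subseteq> X"
  using assms(2)
proof (induction i rule: less_induct)
  case (less i)
  have wf: "wf_circ C" using assms(1) by (simp add: nnf_on_def)
  show ?case
  proof (cases "C ! i")
    case (Lit p x)
    then show ?thesis using less.prems assms(1) by (auto simp: gvars_Lit nnf_on_def)
  next
    case (Const p)
    then show ?thesis using less.prems by (simp add: gvars_Const)
  next
    case (And j k)
    have lt: "j < i" "k < i" using wf_And[OF wf less.prems(1) And] .
    then show ?thesis using less.prems And wf less.IH[of j] less.IH[of k]
      by (simp add: gvars_And)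
  next
    case (Or js)
    have "gvars C j \<subseteq> X" if "j \<in> set js" for j
      using less.prems less.IH[of j] wf_Or(2)[OF wf less.prems(1) Or that] by simp
    then show ?thesis using less.prems Or wf by (auto simp: gvars_Or)
  qed
qed

lemma wf_append:
  assumes "wf_circ A"
    and "\<And>m. m < length B \<Longrightarrow> (case B ! m of
         And j k \<Rightarrow> j < length A + m \<and> k < length A + m
       | Or js \<Rightarrow> distinct js \<and> (\<forall>j\<in>set js. j < length A + m)
       | _ \<Rightarrow> True)"
  shows "wf_circ (A @ B)"
proof -
  have "case (A @ B) ! i of
         And j k \<Rightarrow> j < i \<and> k < i
       | Or js \<Rightarrow> distinct js \<and> (\<forall>j\<in>set js. j < i)
       | _ \<Rightarrow> True" if "i < length (A @ B)" for i
  proof (cases "i < length A")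
    case True
    then show ?thesis using assms(1) by (simp add: wf_circ_def nth_append)
  next
    case False
    then obtain m where i: "i = length A + m" by (metis le_Suc_ex not_less)
    show ?thesis using assms(2)[of m] that unfolding i by simp
  qed
  then show ?thesis using assms(1) by (simp add: wf_circ_def)
qed

lemma ev_append: "i < length A \<Longrightarrow> ev (A @ B) a i = ev A a i"
proof (induction i rule: less_induct)
  case (less i)
  then show ?case
    by (subst (1 2) ev.simps) (auto simp: nth_append split: gate.split)
qed

lemma gvars_append: "i < length A \<Longrightarrow> gvars (A @ B) i = gvars A i"
proof (induction i rule: less_induct)
  case (less i)
  then show ?case
    by (subst (1 2) gvars.simps) (auto simp: nth_append split: gate.split)
qed

section \<open>Juxtaposition of two circuits\<close>

fun shift :: "nat \<Rightarrow> gate \<Rightarrow> gate" where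
  "shift n (Lit b x) = Lit b x"
| "shift n (Const b) = Const b"
| "shift n (And j k) = And (n + j) (n + k)"
| "shift n (Or js) = Or (map ((+) n) js)"

text \<open>Both circuits must live in one list so that gates of both can be members of one
  partition of the assignments. Only the output of \<open>B\<close> remains the last gate; the
  output of \<open>A\<close> keeps its old index.\<close>

definition juxtapose :: "gate list \<Rightarrow> gate list \<Rightarrow> gate list" where
  "juxtapose A B = A @ map (shift (length A)) B"

lemma length_juxtapose [simp]: "length (juxtapose A B) = length A + length B"
  by (simp add: juxtapose_def)

lemma nth_juxtapose:
  "i < length A \<Longrightarrow> juxtapose A B ! i = A ! i"
  "i < length B \<Longrightarrow> juxtapose A B ! (length A + i) = shift (length A) (B ! i)"
  by (simp_all add: juxtapose_def nth_append)

lemma juxtapose_left: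
  assumes "i < length A"
  shows "ev (juxtapose A B) a i = ev A a i" "gvars (juxtapose A B) i = gvars A i"
  using assms by (simp_all add: juxtapose_def ev_append gvars_append)

lemma wf_juxtapose:
  assumes "wf_circ A" "wf_circ B"
  shows "wf_circ (juxtapose A B)"
  unfolding juxtapose_def
proof (rule wf_append[OF assms(1)])
  fix m assume "m < length (map (shift (length A)) B)"
  then have "m < length B" by simp
  then show "case map (shift (length A)) B ! m of
         And j k \<Rightarrow> j < length A + m \<and> k < length A + m
       | Or js \<Rightarrow> distinct js \<and> (\<forall>j\<in>set js. j < length A + m)
       | _ \<Rightarrow> True"
    using assms(2) by (cases "B ! m") (auto simp: wf_circ_def distinct_map dest!: spec[of _ m])
qed

lemma juxtapose_right:
  assumes "wf_circ A" "wf_circ B" "i < length B"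
  shows "ev (juxtapose A B) a (length A + i) = ev B a i"
    and "gvars (juxtapose A B) (length A + i) = gvars B i"
proof -
  let ?C = "juxtapose A B"
  have wf: "wf_circ ?C" using assms by (simp add: wf_juxtapose)
  have "ev ?C a (length A + i) = ev B a i \<and> gvars ?C (length A + i) = gvars B i"
    using assms(3)
  proof (induction i rule: less_induct)
    case (less i)
    note nth = nth_juxtapose(2)[OF less.prems, of A]
    have lt: "length A + i < length ?C" using less.prems by simp
    show ?case
    proof (cases "B ! i")
      case (Lit p x)
      then show ?thesis using less.prems nth lt by (simp add: ev_Lit gvars_Lit)
    next
      case (Const p)
      then show ?thesis using less.prems nth lt by (simp add: ev_Const gvars_Const)
    next
      case (And j k)
      have C: "?C ! (length A + i) = And (length A + j) (length A + k)" using nth And by simp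
      show ?thesis
        using less.IH[of j] less.IH[of k] wf_And[OF assms(2) less.prems And] less.prems
        by (simp add: ev_And[OF wf lt C] ev_And[OF assms(2) less.prems And]
            gvars_And[OF wf lt C] gvars_And[OF assms(2) less.prems And])
    next
      case (Or js)
      have C: "?C ! (length A + i) = Or (map ((+) (length A)) js)" using nth Or by simp
      have "ev ?C a (length A + j) = ev B a j \<and> gvars ?C (length A + j) = gvars B j"
        if "j \<in> set js" for j
        using less.IH[of j] wf_Or(2)[OF assms(2) less.prems Or that] less.prems by simp
      then show ?thesis
        by (simp add: ev_Or[OF wf lt C] ev_Or[OF assms(2) less.prems Or]
            gvars_Or[OF wf lt C] gvars_Or[OF assms(2) less.prems Or])
    qed
  qed
  then show "ev (juxtapose A B) a (length A + i) = ev B a i"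
    and "gvars (juxtapose A B) (length A + i) = gvars B i" by simp_all
qed

section \<open>Vtrees\<close>

lemma vvars_simps [simp]:
  "vvars (VLeaf x) = {x}" "vvars (VNode l r) = vvars l \<union> vvars r"
  by (auto simp: vvars_def)

lemma vleaves_nonempty [simp]: "vleaves v \<noteq> []"
  by (induction v) auto

lemma vsubtrees_refl [simp]: "v \<in> vsubtrees v"
  by (cases v) auto

lemma vsubtrees_trans: "u \<in> vsubtrees v \<Longrightarrow> v \<in> vsubtrees w \<Longrightarrow> u \<in> vsubtrees w"
  by (induction w) auto

lemma vvars_mono: "u \<in> vsubtrees v \<Longrightarrow> vvars u \<subseteq> vvars v"
  by (induction v) auto

lemma distinct_vsubtrees: "u \<in> vsubtrees v \<Longrightarrow> distinct (vleaves v) \<Longrightarrow> distinct (vleaves u)"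
  by (induction v) auto

lemma distinct_VNode_disjoint: "distinct (vleaves (VNode l r)) \<Longrightarrow> vvars l \<inter> vvars r = {}"
  by (simp add: vvars_def)

lemma size_vsubtrees: "u \<in> vsubtrees v \<Longrightarrow> size u \<le> size v"
  by (induction v) auto

text \<open>Subtrees taken from different children of a node have disjoint leaf sets, so overlapping
  ones lie on one branch.\<close>

lemma vsubtrees_laminar:
  assumes "distinct (vleaves T)" "u \<in> vsubtrees T" "v \<in> vsubtrees T" "vvars u \<inter> vvars v \<noteq> {}"
  shows "u \<in> vsubtrees v \<or> v \<in> vsubtrees u"
  using assms
proof (induction T)
  case (VNode l r)
  have "vvars l \<inter> vvars r = {}" using VNode.prems(1) by (rule distinct_VNode_disjoint)
  then have "\<not> (u \<in> vsubtrees l \<and> v \<in> vsubtrees r)" "\<not> (u \<in> vsubtrees r \<and> v \<in> vsubtrees l)"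
    using VNode.prems(4) vvars_mono by blast+
  then show ?case using VNode by auto
qed auto

text \<open>If the leaves are distinct and include all of a nonempty \<open>Y\<close>, this is the
  smallest vtree node above \<open>Y\<close>. The empty set is sent to the leftmost leaf, which is
  why \<open>home_vsubtree\<close> asks for a nonempty set.\<close>

fun home :: "vtree \<Rightarrow> nat set \<Rightarrow> vtree" where
  "home (VLeaf x) Y = VLeaf x"
| "home (VNode l r) Y =
     (if Y \<subseteq> vvars l then home l Y else if Y \<subseteq> vvars r then home r Y else VNode l r)"

lemma home_vsubtrees: "home T Y \<in> vsubtrees T"
  by (induction T) auto

lemma vvars_home: "Y \<subseteq> vvars T \<Longrightarrow> Y \<subseteq> vvars (home T Y)"
  by (induction T) auto

lemma home_vsubtree:
  assumes "distinct (vleaves T)" "v \<in> vsubtrees T" "Y \<subseteq> vvars v" "Y \<noteq> {}"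
  shows "home T Y = home v Y"
  using assms
proof (induction T)
  case (VNode l r)
  have "vvars l \<inter> vvars r = {}" using VNode.prems(1) by (rule distinct_VNode_disjoint)
  then have "\<not> Y \<subseteq> vvars l" if "v \<in> vsubtrees r"
    using VNode.prems(3,4) vvars_mono[OF that] by blast
  moreover have "Y \<subseteq> vvars l" if "v \<in> vsubtrees l"
    using VNode.prems(3) vvars_mono[OF that] by blast
  moreover have "Y \<subseteq> vvars r" if "v \<in> vsubtrees r"
    using VNode.prems(3) vvars_mono[OF that] by blast
  ultimately show ?case using VNode by (cases "v = VNode l r") auto
qed auto

text \<open>Every inner node \<open>VNode l r\<close> with more than two leaves gets an auxiliary variable as its new
  right sibling. As the last leaf of \<open>l\<close> determines the node among all inner nodes of a vtree,
  \<open>M + last (vleaves l)\<close> is fresh if \<open>M\<close> exceeds all variables.\<close>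

fun aug :: "nat \<Rightarrow> vtree \<Rightarrow> vtree" where
  "aug M (VLeaf x) = VLeaf x"
| "aug M (VNode l r) = (if size l = 0 \<and> size r = 0 then VNode l r
     else VNode (VNode (aug M l) (aug M r)) (VLeaf (M + last (vleaves l))))"

text \<open>For more than two leaves this is the left child of \<open>aug M v\<close>, beside the
  auxiliary leaf; otherwise it is \<open>aug M v\<close> itself. Cells are placed here, so that they
  can be primes whose subs sit at the auxiliary leaf.\<close>

fun core :: "nat \<Rightarrow> vtree \<Rightarrow> vtree" where
  "core M (VLeaf x) = VLeaf x"
| "core M (VNode l r) = VNode (aug M l) (aug M r)"

fun aux_leaves :: "nat \<Rightarrow> vtree \<Rightarrow> nat list" where
  "aux_leaves M (VLeaf x) = []"
| "aux_leaves M (VNode l r) = (if size l = 0 \<and> size r = 0 then []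
     else aux_leaves M l @ aux_leaves M r @ [M + last (vleaves l)])"

section \<open>Leaves of the augmented vtree\<close>

lemma vtree_size_0: "size v = 0 \<longleftrightarrow> (\<exists>x. v = VLeaf x)"
  by (cases v) auto

lemma core_vsubtrees_aug: "core M v \<in> vsubtrees (aug M v)"
  by (cases v) (auto simp: vtree_size_0)

lemma aug_vsubtrees: "u \<in> vsubtrees v \<Longrightarrow> aug M u \<in> vsubtrees (aug M v)"
  by (induction v) (auto simp: vtree_size_0)

lemma vvars_aug: "vvars (aug M v) = vvars v \<union> set (aux_leaves M v)"
  by (induction v) auto

lemma length_vleaves: "length (vleaves v) = Suc (size v)"
  by (induction v) auto

text \<open>\<open>size v\<close> counts the inner nodes. Below every inner node, or equal to it, is
  a node with exactly two leaves, and such a node receives no auxiliary variable; so at least one is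
  saved.\<close>

lemma length_aux_leaves: "length (aux_leaves M v) \<le> size v - 1"
  by (induction v) auto

text \<open>The last leaf of \<open>v\<close> does not end the left subtree of any node in
  \<open>v\<close>, hence \<open>butlast\<close>. This keeps the label
  \<open>M + last (vleaves l)\<close> apart from all labels inside \<open>l\<close>.\<close>

lemma aux_leaves_subset: "set (aux_leaves M v) \<subseteq> (+) M ` set (butlast (vleaves v))"
proof (induction v)
  case (VNode l r)
  have "set (butlast (vleaves l)) \<subseteq> set (vleaves l)" by (meson in_set_butlastD subsetI)
  moreover have "last (vleaves l) \<in> set (vleaves l)" by simp
  ultimately show ?case using VNode by (simp add: butlast_append) blast
qed auto

lemma last_notin_butlast: "distinct xs \<Longrightarrow> xs \<noteq> [] \<Longrightarrow> last xs \<notin> set (butlast xs)"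
  by (metis append_butlast_last_id distinct_append disjoint_iff list.set_intros(1))

lemma distinct_aux_leaves: "distinct (vleaves v) \<Longrightarrow> distinct (aux_leaves M v)"
proof (induction v)
  case (VNode l r)
  have sub: "set (butlast (vleaves l)) \<subseteq> set (vleaves l)" "set (butlast (vleaves r)) \<subseteq> set (vleaves r)"
    by (meson in_set_butlastD subsetI)+
  have dis: "set (vleaves l) \<inter> set (vleaves r) = {}" and d: "distinct (vleaves l)" "distinct (vleaves r)"
    using VNode.prems by auto
  have "last (vleaves l) \<notin> set (butlast (vleaves l))" using d by (simp add: last_notin_butlast)
  then have "M + last (vleaves l) \<notin> set (aux_leaves M l)"
    using aux_leaves_subset[of M l] by auto
  moreover have "last (vleaves l) \<notin> set (vleaves r)" using dis by (metis disjoint_iff last_in_set vleaves_nonempty)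
  then have "M + last (vleaves l) \<notin> set (aux_leaves M r)"
    using aux_leaves_subset[of M r] sub(2) by fastforce
  moreover have "set (aux_leaves M l) \<inter> set (aux_leaves M r) = {}"
  proof -
    have "set (butlast (vleaves l)) \<inter> set (butlast (vleaves r)) = {}" using sub dis by blast
    then have "(+) M ` set (butlast (vleaves l)) \<inter> (+) M ` set (butlast (vleaves r)) = {}" by auto
    then show ?thesis using aux_leaves_subset[of M l] aux_leaves_subset[of M r] by blast
  qed
  ultimately show ?case using VNode d by simp
qed auto

lemma distinct_vleaves_aug:
  assumes "distinct (vleaves v)" "\<And>x. x \<in> vvars v \<Longrightarrow> x < M"
  shows "distinct (vleaves (aug M v))"
  using assms
proof (induction v)
  case (VNode l r)
  show ?case
  proof (cases "size l = 0 \<and> size r = 0")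
    case True
    then show ?thesis using VNode.prems by simp
  next
    case False
    have leaves: "set (vleaves (aug M v)) = set (vleaves v) \<union> set (aux_leaves M v)" for v
      using vvars_aug[of M v] by (simp add: vvars_def)
    have ge: "M \<le> y" if "y \<in> set (aux_leaves M w)" for y w
      using aux_leaves_subset[of M w] that by auto
    have lt: "y < M" if "y \<in> set (vleaves l) \<union> set (vleaves r)" for y
      using VNode.prems(2) that by (simp add: vvars_def)
    have d: "distinct (aux_leaves M (VNode l r))" using VNode.prems(1) by (rule distinct_aux_leaves)
    have dis: "set (vleaves l) \<inter> set (vleaves r) = {}" using VNode.prems(1) by simp
    have new: "M + last (vleaves l) \<notin> set (vleaves l) \<union> set (vleaves r)" using lt by fastforce
    have "set (aux_leaves M w) \<inter> set (vleaves l) = {}" "set (aux_leaves M w) \<inter> set (vleaves r) = {}" for w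
      using ge[of _ w] lt by (force simp: disjoint_iff)+
    then have "set (vleaves (aug M l)) \<inter> set (vleaves (aug M r)) = {}"
      using d False dis unfolding leaves by (simp add: Int_Un_distrib Int_Un_distrib2 Int_commute)
    moreover have "distinct (vleaves (aug M l))" "distinct (vleaves (aug M r))" using VNode by auto
    ultimately show ?thesis using False d new by (auto simp: leaves)
  qed
qed auto

section \<open>Building SDDs bottom-up\<close>

lemma sdd_mono:
  assumes "sdd C v i" "v \<in> vsubtrees w"
  shows "sdd C w i"
  using assms(1)
proof cases
  case (sdd_const b)
  then show ?thesis by (rule sdd.sdd_const)
next
  case (sdd_lit b x)
  then show ?thesis using vvars_mono[OF assms(2)] by (intro sdd.sdd_lit) auto
next
  case (sdd_or gs vl vr ps)
  show ?thesis
    by (rule sdd.sdd_or[OF sdd_or(1,2) vsubtrees_trans[OF sdd_or(3) assms(2)] sdd_or(4,5,6)])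
qed

lemma sdd_length: "sdd C v i \<Longrightarrow> i < length C"
  by (erule sdd.cases) simp_all

lemma primes_partition_append:
  assumes "primes_partition C ps" "\<And>m. m < length ps \<Longrightarrow> fst (ps ! m) < length C"
  shows "primes_partition (C @ B) ps"
proof -
  have "\<And>m a. m < length ps \<Longrightarrow> ev (C @ B) a (fst (ps ! m)) = ev C a (fst (ps ! m))"
    using assms(2) by (rule ev_append)
  then show ?thesis using assms(1) unfolding primes_partition_def by metis
qed

lemma sdd_append: "sdd C v i \<Longrightarrow> sdd (C @ B) v i"
proof (induction rule: sdd.induct)
  case (sdd_const i C b T)
  then show ?case by (auto intro!: sdd.sdd_const simp: nth_append)
next
  case (sdd_lit i C b x T)
  then show ?case by (auto intro!: sdd.sdd_lit[where b = b and x = x] simp: nth_append)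
next
  case (sdd_or i C gs vl vr T ps)
  show ?case
  proof (rule sdd.sdd_or)
    show "(C @ B) ! i = Or gs" using sdd_or by (simp add: nth_append)
    show "primes_partition (C @ B) ps"
      using sdd_or by (auto intro!: primes_partition_append dest: sdd_length)
  qed (use sdd_or in \<open>auto simp: nth_append\<close>)
qed

definition node :: "gate list \<Rightarrow> vtree \<Rightarrow> ((nat \<Rightarrow> bool) \<Rightarrow> bool) \<Rightarrow> bool" where
  "node S v F \<longleftrightarrow> (\<exists>i. sdd S v i \<and> (\<forall>a. ev S a i = F a))"

text \<open>Circuits are only extended at the end: indices, values and SDD certificates then
  persist, so gates built earlier can be shared. \<open>n\<close> bounds the number of new
  gates.\<close>

definition grows :: "gate list \<Rightarrow> gate list \<Rightarrow> nat \<Rightarrow> bool" where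
  "grows S S' n \<longleftrightarrow> wf_circ S' \<and> (\<exists>B. S' = S @ B) \<and> length S' \<le> length S + n"

lemma grows_wf: "grows S S' n \<Longrightarrow> wf_circ S'"
  by (simp add: grows_def)

lemma grows_trans: "grows S S' m \<Longrightarrow> grows S' S'' n \<Longrightarrow> grows S S'' (m + n)"
  by (auto simp: grows_def)

lemma grows_le: "grows S S' m \<Longrightarrow> m \<le> n \<Longrightarrow> grows S S' n"
  by (auto simp: grows_def)

lemma node_grows: "node S v F \<Longrightarrow> grows S S' n \<Longrightarrow> node S' v F"
  unfolding node_def grows_def by (metis ev_append sdd_append sdd_length)

lemma node_mono: "node S v F \<Longrightarrow> v \<in> vsubtrees w \<Longrightarrow> node S w F"
  unfolding node_def using sdd_mono by blast

lemma node_const: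
  assumes "wf_circ S"
  shows "\<exists>S'. grows S S' 1 \<and> node S' v (\<lambda>_. b)"
proof (intro exI conjI)
  show "grows S (S @ [Const b]) 1"
    using assms by (auto simp: grows_def intro!: wf_append)
  show "node (S @ [Const b]) v (\<lambda>_. b)"
    unfolding node_def
    by (intro exI[of _ "length S"]) (auto intro: sdd_const simp: ev_Const[of _ _ b])
qed

lemma node_lit:
  assumes "wf_circ S" "x \<in> vvars v"
  shows "\<exists>S'. grows S S' 1 \<and> node S' v (\<lambda>a. a x = b)"
proof (intro exI conjI)
  show "grows S (S @ [Lit b x]) 1"
    using assms by (auto simp: grows_def intro!: wf_append)
  show "node (S @ [Lit b x]) v (\<lambda>a. a x = b)"
    unfolding node_def using assms(2)
    by (intro exI[of _ "length S"]) (auto intro: sdd_lit simp: ev_Lit[of _ _ b x])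
qed

definition depends_on :: "((nat \<Rightarrow> bool) \<Rightarrow> bool) \<Rightarrow> nat set \<Rightarrow> bool" where
  "depends_on F Y \<longleftrightarrow> (\<forall>a b. (\<forall>x\<in>Y. a x = b x) \<longrightarrow> F a = F b)"

text \<open>A function of one variable is a constant or a literal; its values at the two constant
  assignments decide which.\<close>

lemma node_leaf:
  assumes "wf_circ S" "depends_on F {x}"
  shows "\<exists>S'. grows S S' 1 \<and> node S' (VLeaf x) F"
proof -
  have F: "F a = F (\<lambda>_. a x)" for a using assms(2) unfolding depends_on_def by (metis singletonD)
  show ?thesis
  proof (cases "F (\<lambda>_. True) = F (\<lambda>_. False)")
    case True
    have "F a = F (\<lambda>_. True)" for a
      by (subst F) (cases "a x"; simp only: True)
    then have "(\<lambda>_. F (\<lambda>_. True)) = F" by (intro ext[OF sym])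
    then show ?thesis using node_const[OF assms(1), of "VLeaf x" "F (\<lambda>_. True)"] by simp
  next
    case False
    have "F a = (a x = F (\<lambda>_. True))" for a
      by (subst F) (use False in \<open>cases "a x"; simp only: simp_thms; blast\<close>)
    then have "(\<lambda>a. a x = F (\<lambda>_. True)) = F" by (intro ext[OF sym])
    then show ?thesis using node_lit[OF assms(1), of x "VLeaf x" "F (\<lambda>_. True)"] by simp
  qed
qed

text \<open>The pairs in \<open>Fs\<close> are primes with their subs. Every pair gets a fresh
  \<and>-gate and one \<or>-gate goes on top, hence \<open>Suc (length Fs)\<close>. Freshness also
  makes the children of the \<or>-gate distinct, as \<open>wf_circ\<close> demands.\<close>

lemma node_or:
  assumes wf: "wf_circ S" and v: "VNode vl vr \<in> vsubtrees T"
    and nodes: "\<And>F G. (F, G) \<in> set Fs \<Longrightarrow> node S vl F \<and> node S vr G"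
    and sat: "\<And>F G. (F, G) \<in> set Fs \<Longrightarrow> \<exists>a. F a"
    and disj: "\<And>m m' a. m < length Fs \<Longrightarrow> m' < length Fs \<Longrightarrow> m \<noteq> m' \<Longrightarrow>
      \<not> (fst (Fs ! m) a \<and> fst (Fs ! m') a)"
    and cover: "\<And>a. \<exists>(F, G)\<in>set Fs. F a"
  shows "\<exists>S'. grows S S' (Suc (length Fs)) \<and> node S' T (\<lambda>a. \<exists>(F, G)\<in>set Fs. F a \<and> G a)"
proof -
  have "\<forall>p\<in>set Fs. \<exists>i j. sdd S vl i \<and> sdd S vr j \<and> (\<forall>a. ev S a i = fst p a \<and> ev S a j = snd p a)"
    using nodes unfolding node_def by fastforce
  then obtain I J where IJ: "\<And>p. p \<in> set Fs \<Longrightarrow> sdd S vl (I p) \<and> sdd S vr (J p) \<and>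
      (\<forall>a. ev S a (I p) = fst p a \<and> ev S a (J p) = snd p a)"
    by metis
  define k where "k = length Fs"
  define ps where "ps = map (\<lambda>p. (I p, J p)) Fs"
  define gs where "gs = map (\<lambda>m. length S + m) [0..<k]"
  define B where "B = map (\<lambda>p. And (I p) (J p)) Fs @ [Or gs]"
  define S' where "S' = S @ B"
  have lt: "I p < length S" "J p < length S" if "p \<in> set Fs" for p
    using IJ[OF that] by (auto dest: sdd_length)
  have wf': "wf_circ S'"
    unfolding S'_def
  proof (rule wf_append[OF wf])
    fix m assume "m < length B"
    then consider "m < k" | "m = k" by (fastforce simp: B_def k_def)
    then show "case B ! m of
         And j k \<Rightarrow> j < length S + m \<and> k < length S + m
       | Or js \<Rightarrow> distinct js \<and> (\<forall>j\<in>set js. j < length S + m)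
       | _ \<Rightarrow> True"
    proof cases
      case 1
      then have "B ! m = And (I (Fs ! m)) (J (Fs ! m))" by (simp add: B_def nth_append k_def)
      moreover have "Fs ! m \<in> set Fs" using 1 by (simp add: k_def)
      ultimately show ?thesis by (simp add: lt trans_less_add1)
    next
      case 2
      then show ?thesis by (auto simp: B_def nth_append k_def gs_def distinct_map)
    qed
  qed
  have len: "length S' = length S + Suc k" by (simp add: S'_def B_def k_def)
  have nth_And: "S' ! (length S + m) = And (I (Fs ! m)) (J (Fs ! m))" if "m < k" for m
    using that by (simp add: S'_def B_def nth_append k_def)
  have nth_Or: "S' ! (length S + k) = Or gs"
    by (simp add: S'_def B_def nth_append k_def)
  have evI: "ev S' a (I p) = fst p a" "ev S' a (J p) = snd p a" if "p \<in> set Fs" for p a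
    using IJ[OF that] lt[OF that] by (simp_all add: S'_def ev_append)
  have "sdd S' T (length S + k)"
  proof (rule sdd_or)
    show "length S + k < length S'" using len by simp
    show "S' ! (length S + k) = Or gs" by (rule nth_Or)
    show "VNode vl vr \<in> vsubtrees T" by (rule v)
    show "length ps = length gs" by (simp add: ps_def gs_def k_def)
    show "\<forall>m<length gs. gs ! m < length S' \<and> S' ! (gs ! m) = And (fst (ps ! m)) (snd (ps ! m))
        \<and> sdd S' vl (fst (ps ! m)) \<and> sdd S' vr (snd (ps ! m))"
      using IJ[OF nth_mem] nth_And
      by (auto simp: gs_def len ps_def k_def intro!: sdd_append[of S _ _ B, folded S'_def])
    have "\<exists>m<length Fs. fst (Fs ! m) a" for a
      using cover[of a] by (metis (mono_tags, lifting) case_prod_beta in_set_conv_nth)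
    moreover have "\<exists>a. fst (Fs ! m) a" if "m < length Fs" for m
      using sat[of "fst (Fs ! m)" "snd (Fs ! m)"] that by simp
    moreover have "fst (ps ! m) = I (Fs ! m)" "Fs ! m \<in> set Fs" if "m < length Fs" for m
      using that by (simp_all add: ps_def)
    then have "ev S' a (fst (ps ! m)) = fst (Fs ! m) a" if "m < length Fs" for m a
      using that by (simp add: evI)
    moreover have "length ps = length Fs" by (simp add: ps_def)
    ultimately show "primes_partition S' ps"
      using disj unfolding primes_partition_def by metis
  qed
  moreover have "ev S' a (length S + k) = (\<exists>(F, G)\<in>set Fs. F a \<and> G a)" for a
  proof -
    have "ev S' a (length S + m) = (fst (Fs ! m) a \<and> snd (Fs ! m) a)" if "m < k" for m
      using that len nth_mem[of m Fs] by (subst ev_And[OF wf' _ nth_And]) (simp_all add: evI k_def)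
    moreover have "set gs = (+) (length S) ` {..<k}" by (simp add: gs_def lessThan_atLeast0)
    then have "ev S' a (length S + k) = (\<exists>m<k. ev S' a (length S + m))"
      using len by (subst ev_Or[OF wf' _ nth_Or]) auto
    ultimately have "ev S' a (length S + k) = (\<exists>m<k. fst (Fs ! m) a \<and> snd (Fs ! m) a)"
      by blast
    also have "\<dots> = (\<exists>(F, G)\<in>set Fs. F a \<and> G a)"
      unfolding k_def case_prod_beta Bex_def in_set_conv_nth by blast
    finally show ?thesis .
  qed
  ultimately have "node S' T (\<lambda>a. \<exists>(F, G)\<in>set Fs. F a \<and> G a)"
    unfolding node_def by blast
  moreover have "grows S S' (Suc (length Fs))"
    using wf' len by (auto simp: grows_def S'_def k_def)
  ultimately show ?thesis by blast
qed

text \<open>The primes are \<open>F\<close> and its negation; the assignments \<open>a\<close> and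
  \<open>b\<close> witness that both are satisfiable, as a partition requires.\<close>

lemma node_ite:
  assumes "wf_circ S" "node S vl F" "node S vl (\<lambda>a. \<not> F a)" "node S vr G" "node S vr H"
    and "F a" "\<not> F b"
  shows "\<exists>S'. grows S S' 3 \<and> node S' (VNode vl vr) (\<lambda>a. if F a then G a else H a)"
proof -
  let ?Fs = "[(F, G), (\<lambda>a. \<not> F a, H)]"
  have "\<exists>S'. grows S S' (Suc (length ?Fs)) \<and>
      node S' (VNode vl vr) (\<lambda>a. \<exists>(F, G)\<in>set ?Fs. F a \<and> G a)"
  proof (rule node_or)
    show "\<not> (fst (?Fs ! m) a \<and> fst (?Fs ! m') a)"
      if "m < length ?Fs" "m' < length ?Fs" "m \<noteq> m'" for m m' a
      using that by (auto simp: less_Suc_eq)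
  qed (use assms in auto)
  moreover have "(\<lambda>a. \<exists>(F, G)\<in>set ?Fs. F a \<and> G a) = (\<lambda>a. if F a then G a else H a)"
    by (intro ext) auto
  ultimately show ?thesis by (simp add: numeral_3_eq_3)
qed

text \<open>Shannon expansion on \<open>x\<close>: two literals as primes, two cofactors as subs at
  the leaf \<open>y\<close>, and three gates for the decision make 7.\<close>

lemma node_two_leaves:
  assumes wf: "wf_circ S" and F: "depends_on F {x, y}"
  shows "\<exists>S'. grows S S' 7 \<and> node S' (VNode (VLeaf x) (VLeaf y)) F"
proof -
  let ?G = "\<lambda>p a. F (a(x := p))"
  have G: "depends_on (?G p) {y}" for p
    unfolding depends_on_def
  proof (intro allI impI)
    fix a b :: "nat \<Rightarrow> bool"
    assume "\<forall>z\<in>{y}. a z = b z"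
    then have "\<forall>z\<in>{x, y}. (a(x := p)) z = (b(x := p)) z" by auto
    then show "?G p a = ?G p b" using F unfolding depends_on_def by blast
  qed
  obtain S1 where S1: "grows S S1 1" "node S1 (VLeaf x) (\<lambda>a. a x = True)"
    using node_lit[OF wf, of x "VLeaf x" True] by auto
  obtain S2 where S2: "grows S1 S2 1" "node S2 (VLeaf x) (\<lambda>a. a x = False)"
    using node_lit[OF grows_wf[OF S1(1)], of x "VLeaf x" False] by auto
  obtain S3 where S3: "grows S2 S3 1" "node S3 (VLeaf y) (?G True)"
    using node_leaf[OF grows_wf[OF S2(1)] G] by blast
  obtain S4 where S4: "grows S3 S4 1" "node S4 (VLeaf y) (?G False)"
    using node_leaf[OF grows_wf[OF S3(1)] G] by blast
  have "node S4 (VLeaf x) (\<lambda>a. a x)"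
    using S1(2) by (simp add: node_grows[OF node_grows[OF node_grows[OF _ S2(1)] S3(1)] S4(1)])
  moreover have "node S4 (VLeaf x) (\<lambda>a. \<not> a x)"
    using S2(2) by (simp add: node_grows[OF node_grows[OF _ S3(1)] S4(1)])
  ultimately obtain S5 where S5: "grows S4 S5 3"
    "node S5 (VNode (VLeaf x) (VLeaf y)) (\<lambda>a. if a x then ?G True a else ?G False a)"
    using node_ite[OF grows_wf[OF S4(1)], of "VLeaf x" "\<lambda>a. a x" "VLeaf y" "?G True" "?G False"
        "\<lambda>_. True" "\<lambda>_. False"] node_grows[OF S3(2) S4(1)] S4(2) by auto
  have "F a = (if a x then ?G True a else ?G False a)" for a
    using fun_upd_triv[of a x] by (cases "a x") metis+
  then have "(\<lambda>a. if a x then ?G True a else ?G False a) = F" by (intro ext[OF sym])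
  moreover have "grows S S5 7"
    using grows_trans[OF grows_trans[OF grows_trans[OF grows_trans[OF S1(1) S2(1)] S3(1)] S4(1)] S5(1)]
    by simp
  ultimately show ?thesis using S5(2) by auto
qed

text \<open>The output is by convention the last gate, so a copy of the gate in question is
  appended.\<close>

lemma node_output:
  assumes wf: "wf_circ S" and "node S v F"
  shows "\<exists>S'. is_SDD v S' \<and> represents S' F \<and> length S' = Suc (length S)"
proof -
  obtain i where i: "sdd S v i" "\<And>a. ev S a i = F a" using assms(2) by (auto simp: node_def)
  have lt: "i < length S" using i(1) by (rule sdd_length)
  define S' where "S' = S @ [S ! i]"
  let ?n = "length S"
  have nth: "S' ! ?n = S ! i" "S' ! i = S ! i" and n: "?n < length S'" "i < length S'"
    using lt by (simp_all add: S'_def nth_append)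
  have wf': "wf_circ S'"
    unfolding S'_def
  proof (rule wf_append[OF wf])
    fix m assume "m < length [S ! i]"
    then show "case [S ! i] ! m of
         And j k \<Rightarrow> j < length S + m \<and> k < length S + m
       | Or js \<Rightarrow> distinct js \<and> (\<forall>j\<in>set js. j < length S + m)
       | _ \<Rightarrow> True"
      using wf_And[OF wf lt] wf_Or[OF wf lt] less_trans[OF _ lt] by (cases "S ! i") auto
  qed
  have ev': "ev S' a ?n = F a" for a
  proof -
    have "ev S' a ?n = ev S' a i"
      by (cases "S ! i") (simp_all add: ev_Lit[OF n(1)] ev_Lit[OF n(2)] ev_Const[OF n(1)] ev_Const[OF n(2)]
          ev_And[OF wf' n(1)] ev_And[OF wf' n(2)] ev_Or[OF wf' n(1)] ev_Or[OF wf' n(2)] nth)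
    then show ?thesis using lt i(2) by (simp add: S'_def ev_append)
  qed
  have "sdd S' v ?n"
    using sdd_append[OF i(1), of "[S ! i]", folded S'_def]
  proof cases
    case (sdd_const b)
    then show ?thesis using n nth by (intro sdd.sdd_const) auto
  next
    case (sdd_lit b x)
    then show ?thesis using n nth by (intro sdd.sdd_lit) auto
  next
    case (sdd_or gs vl vr ps)
    show ?thesis
      using nth sdd_or(2) by (intro sdd.sdd_or[OF n(1) _ sdd_or(3-6)]) simp
  qed
  then show ?thesis using wf' ev' by (intro exI[of _ S']) (simp add: is_SDD_def represents_def out_def S'_def)
qed

section \<open>Partitions by the gates of a structured circuit\<close>

lemma home_minimal: "home T Y = VNode l r \<Longrightarrow> \<not> Y \<subseteq> vvars l \<and> \<not> Y \<subseteq> vvars r"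
  by (induction T) (auto split: if_splits)

locale structured_circuit =
  fixes C :: "gate list" and T :: vtree
  assumes wf: "wf_circ C"
    and distinct_T: "distinct (vleaves T)"
    and vars_T: "\<And>i. i < length C \<Longrightarrow> gvars C i \<subseteq> vvars T"
    and det: "deterministic C"
    and structured: "\<And>i j k. i < length C \<Longrightarrow> C ! i = And j k \<Longrightarrow>
      \<exists>v\<in>vsubtrees T. respects_node C j k v"
begin

section \<open>Non-constant gates as disjoint unions of cells\<close>

abbreviation E :: "nat \<Rightarrow> (nat \<Rightarrow> bool) \<Rightarrow> bool" where "E i a \<equiv> ev C a i"
abbreviation V :: "nat \<Rightarrow> nat set" where "V i \<equiv> gvars C i"

text \<open>A non-constant gate has at least one variable (\<open>nontrivial_vars\<close>), which
  ties it to a definite place in the vtree.\<close>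

definition nontrivial :: "nat \<Rightarrow> bool" where
  "nontrivial u \<longleftrightarrow> u < length C \<and> (\<exists>a. E u a) \<and> (\<exists>a. \<not> E u a)"

text \<open>These are the cells. Non-constant children guarantee that an \<and>-cell has variables
  on both sides of the vtree node it respects.\<close>

definition proper :: "nat \<Rightarrow> bool" where
  "proper u \<longleftrightarrow> nontrivial u \<and>
     ((\<exists>b x. C ! u = Lit b x) \<or> (\<exists>j k. C ! u = And j k \<and> nontrivial j \<and> nontrivial k))"

definition disjoint_gates :: "nat set \<Rightarrow> bool" where
  "disjoint_gates P \<longleftrightarrow> (\<forall>c\<in>P. \<forall>d\<in>P. c \<noteq> d \<longrightarrow> \<not> (\<exists>a. E c a \<and> E d a))"

text \<open>The last clause makes \<open>{u}\<close> the only decomposition of a cell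
  \<open>u\<close>; it later puts a relevant cell into its own partition.\<close>

definition decomposes :: "nat \<Rightarrow> nat set \<Rightarrow> bool" where
  "decomposes u Q \<longleftrightarrow> (\<forall>c\<in>Q. proper c \<and> V c \<subseteq> V u) \<and> disjoint_gates Q \<and>
     (\<forall>a. E u a = (\<exists>c\<in>Q. E c a)) \<and> (proper u \<longrightarrow> Q = {u})"

definition partitions :: "nat set \<Rightarrow> nat set \<Rightarrow> bool" where
  "partitions Y P \<longleftrightarrow> (\<forall>c\<in>P. proper c \<and> V c \<subseteq> Y) \<and> disjoint_gates P \<and> (\<forall>a. \<exists>c\<in>P. E c a)"

lemma disjoint_gatesD: "disjoint_gates P \<Longrightarrow> c \<in> P \<Longrightarrow> d \<in> P \<Longrightarrow> E c a \<Longrightarrow> E d a \<Longrightarrow> c = d"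
  by (auto simp: disjoint_gates_def)

lemma decomposesD:
  assumes "decomposes u Q"
  shows "c \<in> Q \<Longrightarrow> proper c" "c \<in> Q \<Longrightarrow> V c \<subseteq> V u" "disjoint_gates Q"
    "E u a \<longleftrightarrow> (\<exists>c\<in>Q. E c a)" "proper u \<Longrightarrow> Q = {u}"
  using assms unfolding decomposes_def by blast+

lemma partitionsD:
  assumes "partitions Y P"
  shows "c \<in> P \<Longrightarrow> proper c" "c \<in> P \<Longrightarrow> V c \<subseteq> Y" "disjoint_gates P" "\<exists>c\<in>P. E c a"
  using assms by (auto simp: partitions_def)

lemma nontrivial_length: "nontrivial u \<Longrightarrow> u < length C"
  by (simp add: nontrivial_def)

lemma proper_nontrivial: "proper u \<Longrightarrow> nontrivial u"
  by (simp add: proper_def)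

lemma nontrivial_vars: "nontrivial u \<Longrightarrow> V u \<noteq> {}"
  unfolding nontrivial_def using ev_cong[OF wf, of u] by (metis empty_iff)

lemma proper_And:
  assumes "proper c" "C ! c = And j k"
  shows "nontrivial j" "nontrivial k" "E c a \<longleftrightarrow> E j a \<and> E k a" "V c = V j \<union> V k"
proof -
  show "nontrivial j" "nontrivial k" using assms by (simp_all add: proper_def)
  have lt: "c < length C" using nontrivial_length[OF proper_nontrivial[OF assms(1)]] .
  show "E c a \<longleftrightarrow> E j a \<and> E k a" "V c = V j \<union> V k"
    using ev_And[OF wf lt assms(2)] gvars_And[OF wf lt assms(2)] .
qed

lemma decomposes_self: "proper u \<Longrightarrow> decomposes u {u}"
  by (simp add: decomposes_def disjoint_gates_def)

text \<open>An \<or>-gate takes the union over its children, disjoint by determinism. Falsifiability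
  excludes valid gates, for instance the constant true, which is no union of cells over its empty
  variable set; it passes on to the gates visited by the induction.\<close>

lemma decomposes_exists:
  assumes "u < length C" "\<exists>a. \<not> E u a"
  shows "\<exists>Q. decomposes u Q"
  using assms
proof (induction u rule: less_induct)
  case (less u)
  show ?case
  proof (cases "proper u \<or> (\<forall>a. \<not> E u a)")
    case True
    moreover have "decomposes u {}" if "\<forall>a. \<not> E u a"
      using that by (auto simp: decomposes_def disjoint_gates_def proper_def nontrivial_def)
    ultimately show ?thesis using decomposes_self by blast
  next
    case False
    then have nt: "nontrivial u" and np: "\<not> proper u"
      using less.prems by (auto simp: nontrivial_def)
    show ?thesis
    proof (cases "C ! u")
      case (Lit b x)
      then show ?thesis using nt np by (simp add: proper_def)
    next
      case (Const b)
      then show ?thesis using nt by (auto simp: nontrivial_def ev_Const)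
    next
      case (And j k)
      have lt: "j < u" "k < u" using wf_And[OF wf less.prems(1) And] .
      have ev: "E u a \<longleftrightarrow> E j a \<and> E k a" for a using ev_And[OF wf less.prems(1) And] .
      have V: "V u = V j \<union> V k" using gvars_And[OF wf less.prems(1) And] .
      \<comment> \<open>Since \<open>u\<close> is satisfiable, so are both children. As
        \<open>u\<close> is no cell, one child is constant, hence valid, and \<open>u\<close> agrees
        with the other one.\<close>
      have "(\<forall>a. E j a) \<or> (\<forall>a. E k a)"
        using np nt ev And lt by (auto simp: proper_def nontrivial_def)
      then obtain l where "l = j \<or> l = k" "\<And>a. E u a = E l a" using ev by auto
      then have l: "l < u" "V l \<subseteq> V u" "\<And>a. E u a = E l a" using lt V by auto
      obtain Q where "decomposes l Q" using less.IH[of l] l less.prems by auto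
      then have "decomposes u Q" using l np unfolding decomposes_def by blast
      then show ?thesis ..
    next
      case (Or js)
      have ev: "E u a \<longleftrightarrow> (\<exists>j\<in>set js. E j a)" for a using ev_Or[OF wf less.prems(1) Or] .
      have "\<exists>Q. decomposes j Q" if "j \<in> set js" for j
        using wf_Or(2)[OF wf less.prems(1) Or that] less.prems ev that by (auto intro!: less.IH)
      then obtain Q where Q: "\<And>j. j \<in> set js \<Longrightarrow> decomposes j (Q j)" by metis
      have "disjoint_gates (\<Union>j\<in>set js. Q j)"
        unfolding disjoint_gates_def
      proof (intro ballI impI notI)
        fix c d
        assume "c \<in> (\<Union>j\<in>set js. Q j)" "d \<in> (\<Union>j\<in>set js. Q j)" "c \<noteq> d" "\<exists>a. E c a \<and> E d a"
        then obtain i j a where ij: "i \<in> set js" "j \<in> set js" "c \<in> Q i" "d \<in> Q j" "E c a" "E d a"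
          by blast
        then have "E i a" "E j a" using Q decomposesD(4) by blast+
        then have "i = j" using det Or less.prems(1) ij(1,2) unfolding deterministic_def by blast
        then show False using ij Q decomposesD(3) disjoint_gatesD \<open>c \<noteq> d\<close> by blast
      qed
      moreover have "V u = (\<Union>j\<in>set js. V j)" using gvars_Or[OF wf less.prems(1) Or] .
      moreover have "proper c \<and> V c \<subseteq> V j" if "c \<in> Q j" "j \<in> set js" for c j
        using that Q decomposesD(1,2) by blast
      moreover have "E u a \<longleftrightarrow> (\<exists>c\<in>(\<Union>j\<in>set js. Q j). E c a)" for a
      proof -
        have "E j a \<longleftrightarrow> (\<exists>c\<in>Q j. E c a)" if "j \<in> set js" for j
          by (rule decomposesD(4)[OF Q[OF that]])
        then show ?thesis unfolding ev by blast
      qed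
      ultimately have "decomposes u (\<Union>j\<in>set js. Q j)"
        unfolding decomposes_def using np by (auto; blast)
      then show ?thesis ..
    qed
  qed
qed

section \<open>Splitting cells and restricting partitions at a vtree node\<close>

definition cells :: "nat \<Rightarrow> nat set" where
  "cells u = (SOME Q. decomposes u Q)"

lemma decomposes_cells: "nontrivial u \<Longrightarrow> decomposes u (cells u)"
  unfolding cells_def by (rule someI_ex, rule decomposes_exists) (auto simp: nontrivial_def)

definition splits :: "nat \<Rightarrow> nat \<Rightarrow> nat \<Rightarrow> nat set \<Rightarrow> nat set \<Rightarrow> bool" where
  "splits c p s A B \<longleftrightarrow> (C ! c = And p s \<or> C ! c = And s p) \<and> V p \<subseteq> A \<and> V s \<subseteq> B"

lemma splitsD:
  assumes "splits c p s A B" "proper c"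
  shows "nontrivial p" "nontrivial s" "E c a \<longleftrightarrow> E p a \<and> E s a" "V p \<subseteq> A" "V s \<subseteq> B" "V c = V p \<union> V s"
  using assms proper_And unfolding splits_def by blast+

text \<open>Both parts have variables and \<open>A\<close>, \<open>B\<close> are disjoint, so the
  order of the children is forced.\<close>

lemma splits_unique:
  assumes "splits c p s A B" "splits c p' s' A B" "proper c" "A \<inter> B = {}"
  shows "p = p'" "s = s'"
proof -
  have "V p \<noteq> {}" "V s \<noteq> {}" using assms splitsD(1,2) nontrivial_vars by blast+
  then have "\<not> V p \<subseteq> B" "\<not> V s \<subseteq> A" using assms(1,4) by (auto simp: splits_def)
  then show "p = p'" "s = s'" using assms(1,2) by (auto simp: splits_def)
qed

text \<open>Fixing the variables in \<open>B\<close> as in \<open>b\<close> turns a partition of the assignments of \<open>A \<union> B\<close> into one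
  of the assignments of \<open>A\<close>: an \<open>\<and>\<close>-gate across \<open>A\<close> and \<open>B\<close> survives with its part on \<open>A\<close> if \<open>b\<close>
  satisfies its part on \<open>B\<close>. The cell \<open>c0\<close> prevents a cell over \<open>B\<close> alone from surviving.\<close>

lemma partitions_restrict:
  assumes P: "partitions (A \<union> B) P" and AB: "A \<inter> B = {}"
    and split: "\<And>c. c \<in> P \<Longrightarrow> V c \<subseteq> A \<or> V c \<subseteq> B \<or> (\<exists>p s. splits c p s A B)"
    and c0: "c0 \<in> P" "\<not> V c0 \<subseteq> B" "E c0 b"
  shows "\<exists>P'. partitions A P' \<and> {c \<in> P. V c \<subseteq> A} \<subseteq> P' \<and>
    (\<forall>p s. splits c0 p s A B \<longrightarrow> cells p \<subseteq> P')"
proof -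
  define mix where "mix a = (\<lambda>x. if x \<in> A then a x else b x)" for a :: "nat \<Rightarrow> bool"
  have mixA: "E u (mix a) = E u a" if "nontrivial u" "V u \<subseteq> A" for u a
    using that by (intro ev_cong[OF wf]) (auto simp: mix_def nontrivial_def)
  have mixB: "E u (mix a) = E u b" if "nontrivial u" "V u \<subseteq> B" for u a
    using that AB by (intro ev_cong[OF wf]) (auto simp: mix_def nontrivial_def)
  note proper = partitionsD(1)[OF P]
  define P' where "P' = {c \<in> P. V c \<subseteq> A} \<union>
    {x. \<exists>c p s. c \<in> P \<and> splits c p s A B \<and> E s b \<and> x \<in> cells p}"
  \<comment> \<open>Every \<open>x\<close> in \<open>P'\<close> stems from some \<open>c\<close> in
    \<open>P\<close> that holds at \<open>mix a\<close> whenever \<open>x\<close> holds at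
    \<open>a\<close>; this pulls disjointness of \<open>P'\<close> back to that of
    \<open>P\<close>.\<close>
  have P'_cases: "\<exists>c\<in>P. (\<forall>a. E x a \<longrightarrow> E c (mix a)) \<and>
      (c = x \<and> V x \<subseteq> A \<or> (\<exists>p s. splits c p s A B \<and> x \<in> cells p))" if x: "x \<in> P'" for x
  proof (cases "x \<in> P \<and> V x \<subseteq> A")
    case True
    then show ?thesis using proper proper_nontrivial mixA by blast
  next
    case False
    then obtain c p s where cps: "c \<in> P" "splits c p s A B" "E s b" "x \<in> cells p"
      using x by (auto simp: P'_def)
    note sp = splitsD[OF cps(2) proper[OF cps(1)]]
    have "E c (mix a)" if "E x a" for a
    proof -
      have "E p a" using decomposesD(4)[OF decomposes_cells[OF sp(1)]] cps(4) that by blast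
      then show ?thesis using sp(3) mixA[OF sp(1,4)] mixB[OF sp(2,5)] cps(3) by blast
    qed
    then show ?thesis using cps by blast
  qed
  have P'_proper: "proper x \<and> V x \<subseteq> A" if x: "x \<in> P'" for x
  proof -
    obtain c where c: "c \<in> P" "c = x \<and> V x \<subseteq> A \<or> (\<exists>p s. splits c p s A B \<and> x \<in> cells p)"
      using P'_cases[OF x] by blast
    then show ?thesis
      using proper[OF c(1)] splitsD(1,4)[OF _ proper[OF c(1)]] decomposesD(1,2)[OF decomposes_cells]
      by blast
  qed
  have "disjoint_gates P'"
    unfolding disjoint_gates_def
  proof (intro ballI impI notI)
    fix x y assume xy: "x \<in> P'" "y \<in> P'" "x \<noteq> y" "\<exists>a. E x a \<and> E y a"
    then obtain a where a: "E x a" "E y a" by blast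
    obtain c where c: "c \<in> P" "E c (mix a)" "c = x \<and> V x \<subseteq> A \<or> (\<exists>p s. splits c p s A B \<and> x \<in> cells p)"
      using P'_cases[OF xy(1)] a by blast
    obtain d where d: "d \<in> P" "E d (mix a)" "d = y \<and> V y \<subseteq> A \<or> (\<exists>p s. splits d p s A B \<and> y \<in> cells p)"
      using P'_cases[OF xy(2)] a by blast
    have cd: "c = d" using disjoint_gatesD[OF partitionsD(3)[OF P]] c d by blast
    \<comment> \<open>A split cell has variables outside \<open>A\<close>, so \<open>c\<close>
      cannot have entered \<open>P'\<close> in both ways; \<open>x\<close> and \<open>y\<close> are
      then both cells of the \<open>A\<close>-part of the same \<open>c\<close>.\<close>
    have "\<not> V c \<subseteq> A" if "splits c p s A B" for p s
      using splitsD(2,5,6)[OF that proper[OF c(1)]] nontrivial_vars AB by blast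
    then obtain p s p' s' where ps: "splits c p s A B" "x \<in> cells p" "splits c p' s' A B" "y \<in> cells p'"
      using c(3) d(3) cd xy(3) by blast
    have "p' = p" using splits_unique[OF ps(3,1) proper[OF c(1)] AB] by simp
    then have "x = y"
      using disjoint_gatesD[OF decomposesD(3)[OF decomposes_cells] ps(2) _ a]
        splitsD(1)[OF ps(1) proper[OF c(1)]] ps(4) by blast
    then show False using xy(3) by simp
  qed
  moreover have "\<exists>x\<in>P'. E x a" for a
  proof -
    obtain c where c: "c \<in> P" "E c (mix a)" using partitionsD(4)[OF P] by blast
    note nt = proper_nontrivial[OF proper[OF c(1)]]
    \<comment> \<open>A cell over \<open>B\<close> alone would hold at \<open>b\<close> and hence be
      \<open>c0\<close>, which has a variable outside \<open>B\<close>.\<close>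
    have "\<not> V c \<subseteq> B"
    proof
      assume B: "V c \<subseteq> B"
      then have "E c b" using mixB[OF nt B] c(2) by simp
      then have "c = c0" using disjoint_gatesD[OF partitionsD(3)[OF P]] c c0 by blast
      then show False using c0 B by simp
    qed
    then consider "V c \<subseteq> A" | p s where "splits c p s A B" using split[OF c(1)] by blast
    then show ?thesis
    proof cases
      case 1
      then show ?thesis using c mixA[OF nt] by (auto simp: P'_def)
    next
      case 2
      note sp = splitsD[OF 2 proper[OF c(1)]]
      have "E p a" "E s b" using c(2) sp(3) mixA[OF sp(1,4)] mixB[OF sp(2,5)] by blast+
      then obtain x where "x \<in> cells p" "E x a"
        using decomposesD(4)[OF decomposes_cells[OF sp(1)]] by blast
      then show ?thesis using c(1) 2 \<open>E s b\<close> by (auto simp: P'_def)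
    qed
  qed
  ultimately have "partitions A P'" using P'_proper by (simp add: partitions_def)
  moreover have "cells p \<subseteq> P'" if "splits c0 p s A B" for p s
    using that c0 splitsD(3)[OF that proper[OF c0(1)]] by (auto simp: P'_def)
  ultimately show ?thesis by (intro exI[of _ P']) (auto simp: P'_def)
qed

text \<open>The vtree node respected by an \<and>-cell overlaps the given node, so one lies below
  the other. Were it strictly above, \<open>V c\<close> would lie on one of its sides, although the
  two children of the cell have variables on different sides.\<close>

lemma proper_trichotomy:
  assumes v: "VNode l r \<in> vsubtrees T" and c: "proper c" "V c \<subseteq> vvars (VNode l r)"
  obtains "V c \<subseteq> vvars l" | "V c \<subseteq> vvars r"
  | j k where "C ! c = And j k" "V j \<subseteq> vvars l" "V k \<subseteq> vvars r"
proof -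
  have lt: "c < length C" using c by (simp add: proper_def nontrivial_def)
  consider b x where "C ! c = Lit b x" | j k where "C ! c = And j k" using c by (auto simp: proper_def)
  then show ?thesis
  proof cases
    case 1
    then show ?thesis using that(1,2) c(2) lt by (auto simp: gvars_Lit)
  next
    case 2
    obtain wl wr where w: "VNode wl wr \<in> vsubtrees T" "V j \<subseteq> vvars wl" "V k \<subseteq> vvars wr"
      using structured[OF lt 2] by (auto simp: respects_node_def)
    have ne: "V j \<noteq> {}" "V k \<noteq> {}" using proper_And(1,2)[OF c(1) 2] nontrivial_vars by auto
    have V: "V c = V j \<union> V k" using proper_And(4)[OF c(1) 2] .
    have dis: "vvars wl \<inter> vvars wr = {}"
      using distinct_VNode_disjoint distinct_vsubtrees[OF w(1) distinct_T] by blast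
    have "vvars (VNode wl wr) \<inter> vvars (VNode l r) \<noteq> {}" using V c(2) w ne by fastforce
    then consider "VNode wl wr \<in> vsubtrees (VNode l r)" | "VNode l r \<in> vsubtrees (VNode wl wr)"
      using vsubtrees_laminar[OF distinct_T w(1) v] by blast
    then show ?thesis
    proof cases
      case 1
      then consider "wl = l" "wr = r" | "VNode wl wr \<in> vsubtrees l" | "VNode wl wr \<in> vsubtrees r" by auto
      then show ?thesis
      proof cases
        case 1
        then show ?thesis using that(3) 2 w by blast
      next
        case 2
        from vvars_mono[OF this] have "V c \<subseteq> vvars l" using V w by auto
        then show ?thesis by (rule that(1))
      next
        case 3
        from vvars_mono[OF this] have "V c \<subseteq> vvars r" using V w by auto
        then show ?thesis by (rule that(2))
      qed
    next
      case 2: 2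
      have "\<not> V c \<subseteq> vvars wl" "\<not> V c \<subseteq> vvars wr" using V w ne dis by blast+
      then have "VNode l r \<notin> vsubtrees wl" "VNode l r \<notin> vsubtrees wr"
        using c(2) vvars_mono by blast+
      then show ?thesis using 2 that(3) \<open>C ! c = And j k\<close> w by auto
    qed
  qed
qed

text \<open>The gates for which the construction provides an SDD, together with one for the complement.\<close>

definition relevant :: "nat \<Rightarrow> bool" where
  "relevant u \<longleftrightarrow> nontrivial u \<and>
     (\<exists>P Q. partitions (vvars (home T (V u))) P \<and> Q \<subseteq> P \<and> decomposes u Q)"

text \<open>Induction down the vtree from \<open>v\<close> to the home of \<open>u\<close>. Each
  step restricts the partition to the side containing \<open>V u\<close>; the members of
  \<open>Q\<close> lie on that side and survive.\<close>

lemma relevantI: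
  assumes "v \<in> vsubtrees T" "partitions (vvars v) P" "Q \<subseteq> P" "decomposes u Q" "nontrivial u"
    "V u \<subseteq> vvars v"
  shows "relevant u"
  using assms(1-3,6)
proof (induction v arbitrary: P)
  case (VLeaf x)
  have "home T (V u) = VLeaf x"
    using home_vsubtree[OF distinct_T VLeaf.prems(1,4)] nontrivial_vars[OF assms(5)] by simp
  then show ?case using VLeaf assms(4,5) by (auto simp: relevant_def)
next
  case (VNode l r)
  have dis: "vvars l \<inter> vvars r = {}"
    using distinct_VNode_disjoint distinct_vsubtrees[OF VNode.prems(1) distinct_T] by blast
  have sub: "l \<in> vsubtrees T" "r \<in> vsubtrees T"
    using vsubtrees_trans[OF _ VNode.prems(1)] by simp_all
  \<comment> \<open>A member of \<open>Q\<close> that holds at \<open>a\<close> will be the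
    distinguished cell of the restriction: having its variables in \<open>V u\<close>, it is not
    over the other side.\<close>
  obtain a where "E u a" using assms(5) by (auto simp: nontrivial_def)
  then obtain c0 where c0: "c0 \<in> Q" "E c0 a" using decomposesD(4)[OF assms(4)] by blast
  have c0': "c0 \<in> P" "V c0 \<noteq> {}" "V c0 \<subseteq> V u"
    using c0(1) VNode.prems(3) decomposesD(1,2)[OF assms(4)] proper_nontrivial nontrivial_vars by blast+
  have Q: "V c \<subseteq> V u" if "c \<in> Q" for c using that decomposesD(2)[OF assms(4)] by blast
  have split: "V c \<subseteq> vvars l \<or> V c \<subseteq> vvars r \<or> (\<exists>p s. splits c p s (vvars l) (vvars r))"
    "V c \<subseteq> vvars r \<or> V c \<subseteq> vvars l \<or> (\<exists>p s. splits c p s (vvars r) (vvars l))" if "c \<in> P" for c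
    using partitionsD(1,2)[OF VNode.prems(2) that]
    by (auto elim!: proper_trichotomy[OF VNode.prems(1)] simp: splits_def)
  consider "V u \<subseteq> vvars l" | "V u \<subseteq> vvars r" | "\<not> V u \<subseteq> vvars l" "\<not> V u \<subseteq> vvars r" by blast
  then show ?case
  proof cases
    case 1
    then have "\<not> V c0 \<subseteq> vvars r" using c0' dis by blast
    then obtain P' where "partitions (vvars l) P'" "{c \<in> P. V c \<subseteq> vvars l} \<subseteq> P'"
      using partitions_restrict[OF _ dis split(1) c0'(1) _ c0(2)] VNode.prems(2) by auto
    moreover have "Q \<subseteq> {c \<in> P. V c \<subseteq> vvars l}" using 1 Q VNode.prems(3) by blast
    ultimately show ?thesis using 1 by (intro VNode.IH(1)[OF sub(1), of P']) auto
  next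
    case 2
    then have "\<not> V c0 \<subseteq> vvars l" using c0' dis by blast
    then obtain P' where "partitions (vvars r) P'" "{c \<in> P. V c \<subseteq> vvars r} \<subseteq> P'"
      using partitions_restrict[of "vvars r" "vvars l", OF _ _ split(2) c0'(1) _ c0(2)] VNode.prems(2) dis
      by (auto simp: Un_commute Int_commute)
    moreover have "Q \<subseteq> {c \<in> P. V c \<subseteq> vvars r}" using 2 Q VNode.prems(3) by blast
    ultimately show ?thesis using 2 by (intro VNode.IH(2)[OF sub(2), of P']) auto
  next
    case 3
    then have "home T (V u) = VNode l r"
      using home_vsubtree[OF distinct_T VNode.prems(1,4)] nontrivial_vars[OF assms(5)] by simp
    then show ?thesis using VNode.prems assms(4,5) by (auto simp: relevant_def)
  qed
qed

text \<open>The partition at the home of \<open>c\<close> contains \<open>c\<close>. Restricting it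
  to either side, with \<open>c\<close> as the distinguished cell, leaves a partition containing the
  cells of the child on that side, so \<open>relevantI\<close> applies to both children.\<close>

lemma relevant_And:
  assumes rel: "relevant c" and c: "proper c" "C ! c = And j k"
  obtains l r where "home T (V c) = VNode l r" "V j \<subseteq> vvars l" "V k \<subseteq> vvars r" "relevant j" "relevant k"
proof -
  note nt = proper_And(1,2)[OF c]
  have ne: "V j \<noteq> {}" "V k \<noteq> {}" using nt nontrivial_vars by auto
  have lt: "c < length C" using nontrivial_length[OF proper_nontrivial[OF c(1)]] .
  obtain P Q where P: "partitions (vvars (home T (V c))) P" "Q \<subseteq> P" "decomposes c Q"
    using rel by (auto simp: relevant_def)
  then have cP: "c \<in> P" using decomposesD(5) c(1) by blast
  have V: "V c = V j \<union> V k" using proper_And(4)[OF c] .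
  have sub: "V c \<subseteq> vvars (home T (V c))" using vvars_home[OF vars_T[OF lt]] .
  show ?thesis
  proof (cases "home T (V c)")
    case (VLeaf x)
    obtain wl wr where w: "VNode wl wr \<in> vsubtrees T" "V j \<subseteq> vvars wl" "V k \<subseteq> vvars wr"
      using structured[OF lt c(2)] by (auto simp: respects_node_def)
    have "vvars wl \<inter> vvars wr = {}"
      using distinct_VNode_disjoint distinct_vsubtrees[OF w(1) distinct_T] by blast
    \<comment> \<open>At a leaf both children would have exactly the variable \<open>x\<close>,
      against disjointness of the two sides.\<close>
    moreover have "V j = {x}" "V k = {x}" using sub VLeaf V ne by auto
    ultimately show ?thesis using w by auto
  next
    case (VNode l r)
    have v: "VNode l r \<in> vsubtrees T" using home_vsubtrees[of T "V c"] VNode by simp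
    have dis: "vvars l \<inter> vvars r = {}"
      using distinct_VNode_disjoint distinct_vsubtrees[OF v distinct_T] by blast
    have subt: "l \<in> vsubtrees T" "r \<in> vsubtrees T" using vsubtrees_trans[OF _ v] by simp_all
    have min: "\<not> V c \<subseteq> vvars l" "\<not> V c \<subseteq> vvars r" using home_minimal[OF VNode] by auto
    have jk: "V j \<subseteq> vvars l" "V k \<subseteq> vvars r"
      using proper_trichotomy[OF v c(1)] sub VNode min c(2) by (metis gate.inject(3))+
    have split: "V d \<subseteq> vvars l \<or> V d \<subseteq> vvars r \<or> (\<exists>p s. splits d p s (vvars l) (vvars r))"
      "V d \<subseteq> vvars r \<or> V d \<subseteq> vvars l \<or> (\<exists>p s. splits d p s (vvars r) (vvars l))" if "d \<in> P" for d
      using partitionsD(1,2)[OF P(1) that] VNode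
      by (auto elim!: proper_trichotomy[OF v] simp: splits_def)
    have spl: "splits c j k (vvars l) (vvars r)" "splits c k j (vvars r) (vvars l)"
      using jk c(2) by (auto simp: splits_def)
    obtain a where a: "E c a" using proper_nontrivial[OF c(1)] by (auto simp: nontrivial_def)
    obtain P1 where P1: "partitions (vvars l) P1" "cells j \<subseteq> P1"
      using partitions_restrict[OF _ dis split(1) cP min(2) a] P(1) VNode spl(1) by auto
    obtain P2 where P2: "partitions (vvars r) P2" "cells k \<subseteq> P2"
      using partitions_restrict[of "vvars r" "vvars l", OF _ _ split(2) cP min(1) a] P(1) VNode spl(2) dis
      by (auto simp: Un_commute Int_commute)
    have "relevant j" "relevant k"
      using relevantI[OF subt(1) P1 decomposes_cells[OF nt(1)] nt(1) jk(1)]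
        relevantI[OF subt(2) P2 decomposes_cells[OF nt(2)] nt(2) jk(2)] .
    then show ?thesis using that VNode jk by blast
  qed
qed

text \<open>A cell decomposes into itself, so the given partition already serves as input to
  \<open>relevantI\<close>, started at the home of \<open>u\<close>.\<close>

lemma relevant_cell:
  assumes "partitions (vvars (home T (V u))) P" "c \<in> P"
  shows "relevant c" "home T (V c) \<in> vsubtrees (home T (V u))"
proof -
  have c: "proper c" "V c \<subseteq> vvars (home T (V u))" using partitionsD(1,2)[OF assms] .
  note nt = proper_nontrivial[OF c(1)]
  show "relevant c"
    using assms c by (intro relevantI[OF home_vsubtrees assms(1) _ decomposes_self[OF c(1)] nt]) auto
  show "home T (V c) \<in> vsubtrees (home T (V u))"
    using home_vsubtree[OF distinct_T home_vsubtrees c(2) nontrivial_vars[OF nt]] home_vsubtrees by simp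
qed

section \<open>Building the SDD\<close>

text \<open>Cells stay at \<open>core\<close>, which leaves the auxiliary leaf free for the subs of
  the other gates with the same home.\<close>

definition target :: "nat \<Rightarrow> nat \<Rightarrow> vtree" where
  "target M u = (if proper u then core M (home T (V u)) else aug M (home T (V u)))"

definition provides :: "nat \<Rightarrow> gate list \<Rightarrow> nat \<Rightarrow> bool" where
  "provides M S u \<longleftrightarrow> node S (target M u) (E u) \<and> node S (target M u) (\<lambda>a. \<not> E u a)"

text \<open>The order of construction: by size of the home, and at the same home cells before the
  gates that are unions of them. The factor 2 makes room for this tie-break.\<close>

definition rank :: "nat \<Rightarrow> nat" where
  "rank u = 2 * size (home T (V u)) + (if proper u then 0 else 1)"

lemma provides_grows: "provides M S u \<Longrightarrow> grows S S' n \<Longrightarrow> provides M S' u"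
  by (auto simp: provides_def intro: node_grows)

lemma target_vsubtrees: "target M u \<in> vsubtrees (aug M (home T (V u)))"
  by (simp add: target_def core_vsubtrees_aug)

lemma depends_on_E:
  assumes "u < length C" "V u \<subseteq> Y"
  shows "depends_on (E u) Y" "depends_on (\<lambda>a. \<not> E u a) Y"
proof -
  have "E u a = E u b" if "\<forall>x\<in>Y. a x = b x" for a b
    using that assms by (intro ev_cong[OF wf]) auto
  then show "depends_on (E u) Y" "depends_on (\<lambda>a. \<not> E u a) Y"
    unfolding depends_on_def by blast+
qed

lemma V_home: "u < length C \<Longrightarrow> V u \<subseteq> vvars (home T (V u))"
  by (rule vvars_home[OF vars_T])

lemma provides_leaf:
  assumes S: "wf_circ S" and u: "u < length C" "home T (V u) = VLeaf x"
  shows "\<exists>S'. grows S S' 2 \<and> provides M S' u"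
proof -
  have V: "V u \<subseteq> {x}" using V_home[OF u(1)] u(2) by simp
  obtain S1 where S1: "grows S S1 1" "node S1 (VLeaf x) (E u)"
    using node_leaf[OF S depends_on_E(1)[OF u(1) V]] by blast
  obtain S2 where S2: "grows S1 S2 1" "node S2 (VLeaf x) (\<lambda>a. \<not> E u a)"
    using node_leaf[OF grows_wf[OF S1(1)] depends_on_E(2)[OF u(1) V]] by blast
  have "provides M S2 u"
    using node_grows[OF S1(2) S2(1)] S2(2) u(2) by (simp add: provides_def target_def)
  then show ?thesis using grows_trans[OF S1(1) S2(1)] by (auto simp: numeral_2_eq_2)
qed

lemma provides_two_leaves:
  assumes S: "wf_circ S" and u: "u < length C" "home T (V u) = VNode (VLeaf x) (VLeaf y)"
  shows "\<exists>S'. grows S S' 14 \<and> provides M S' u"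
proof -
  have V: "V u \<subseteq> {x, y}" using V_home[OF u(1)] u(2) by auto
  let ?v = "VNode (VLeaf x) (VLeaf y)"
  obtain S1 where S1: "grows S S1 7" "node S1 ?v (E u)"
    using node_two_leaves[OF S depends_on_E(1)[OF u(1) V]] by blast
  obtain S2 where S2: "grows S1 S2 7" "node S2 ?v (\<lambda>a. \<not> E u a)"
    using node_two_leaves[OF grows_wf[OF S1(1)] depends_on_E(2)[OF u(1) V]] by blast
  have "provides M S2 u"
    using node_grows[OF S1(2) S2(1)] S2(2) u(2) by (simp add: provides_def target_def)
  moreover have "grows S S2 14" using grows_trans[OF S1(1) S2(1)] by simp
  ultimately show ?thesis by blast
qed

lemma target_below:
  assumes v: "v \<in> vsubtrees T" and u: "nontrivial u" "V u \<subseteq> vvars v"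
  shows "target M u \<in> vsubtrees (aug M v)" "size (home T (V u)) \<le> size v"
proof -
  have "home T (V u) \<in> vsubtrees v"
    using home_vsubtree[OF distinct_T v u(2) nontrivial_vars[OF u(1)]] home_vsubtrees by simp
  then show "target M u \<in> vsubtrees (aug M v)" "size (home T (V u)) \<le> size v"
    using vsubtrees_trans[OF target_vsubtrees aug_vsubtrees] size_vsubtrees by blast+
qed

text \<open>The complement of \<open>u\<close> is
  \<open>(j \<and> \<not> k) \<or> (\<not> j \<and> \<top>)\<close>. Two constants and two decisions
  of three gates each make 8.\<close>

lemma provides_And:
  assumes S: "wf_circ S" and u: "relevant u" "proper u" "C ! u = And j k"
    and IH: "\<And>c. relevant c \<Longrightarrow> rank c < rank u \<Longrightarrow> provides M S c"
  shows "\<exists>S'. grows S S' 8 \<and> provides M S' u"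
proof -
  obtain l r where lr: "home T (V u) = VNode l r" "V j \<subseteq> vvars l" "V k \<subseteq> vvars r"
    "relevant j" "relevant k"
    using relevant_And[OF u] by metis
  have v: "VNode l r \<in> vsubtrees T" using home_vsubtrees[of T "V u"] lr(1) by simp
  have sub: "l \<in> vsubtrees T" "r \<in> vsubtrees T" using vsubtrees_trans[OF _ v] by simp_all
  note nt = proper_And(1,2)[OF u(2,3)] and ev = proper_And(3)[OF u(2,3)]
  note below = target_below[OF sub(1) nt(1) lr(2)] target_below[OF sub(2) nt(2) lr(3)]
  have "provides M S j" "provides M S k"
    using below(2,4) u(2) lr by (auto intro!: IH simp: rank_def)
  then have jk: "node S (aug M l) (E j)" "node S (aug M l) (\<lambda>a. \<not> E j a)"
    "node S (aug M r) (E k)" "node S (aug M r) (\<lambda>a. \<not> E k a)"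
    using below(1,3) node_mono unfolding provides_def by blast+
  have tgt: "target M u = VNode (aug M l) (aug M r)" using u(2) lr(1) by (simp add: target_def)
  obtain a b where ab: "E j a" "\<not> E j b" using nt(1) by (auto simp: nontrivial_def)
  obtain S1 where S1: "grows S S1 1" "node S1 (aug M r) (\<lambda>_. False)" using node_const[OF S] by blast
  obtain S2 where S2: "grows S1 S2 1" "node S2 (aug M r) (\<lambda>_. True)"
    using node_const[OF grows_wf[OF S1(1)]] by blast
  note jk2 = jk[THEN node_grows[OF _ S1(1)], THEN node_grows[OF _ S2(1)]]
  obtain S3 where S3: "grows S2 S3 3"
    "node S3 (VNode (aug M l) (aug M r)) (\<lambda>a. if E j a then E k a else False)"
    using node_ite[OF grows_wf[OF S2(1)] jk2(1-3) node_grows[OF S1(2) S2(1)] ab] by blast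
  obtain S4 where S4: "grows S3 S4 3"
    "node S4 (VNode (aug M l) (aug M r)) (\<lambda>a. if E j a then \<not> E k a else True)"
    using node_ite[OF grows_wf[OF S3(1)] jk2(1,2,4)[THEN node_grows[OF _ S3(1)]]
        node_grows[OF S2(2) S3(1)] ab] by blast
  have "(\<lambda>a. if E j a then E k a else False) = E u"
    "(\<lambda>a. if E j a then \<not> E k a else True) = (\<lambda>a. \<not> E u a)"
    using ev by (auto intro!: ext)
  then have "provides M S4 u"
    using node_grows[OF S3(2) S4(1)] S4(2) unfolding provides_def tgt by simp
  moreover have "grows S S4 8"
    using grows_trans[OF grows_trans[OF grows_trans[OF S1(1) S2(1)] S3(1)] S4(1)] by simp
  ultimately show ?thesis by blast
qed

text \<open>The sub of a cell is true exactly if the cell is in \<open>Q\<close>. The primes are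
  distinct gates of \<open>C\<close>, so there are at most \<open>length C\<close> of them; this is
  the source of the quadratic size.\<close>

lemma node_cells:
  assumes S: "wf_circ S" and P: "partitions Y P" and Q: "Q \<subseteq> P"
    and cells: "\<And>c. c \<in> P \<Longrightarrow> node S v (E c)"
    and const: "node S w (\<lambda>_. True)" "node S w (\<lambda>_. False)"
  shows "\<exists>S'. grows S S' (Suc (length C)) \<and> node S' (VNode v w) (\<lambda>a. \<exists>c\<in>Q. E c a)"
proof -
  have sub: "P \<subseteq> {..<length C}"
    using partitionsD(1)[OF P] proper_nontrivial nontrivial_length by blast
  then have fin: "finite P" using finite_subset by blast
  then obtain cs where cs: "set cs = P" "distinct cs" using finite_distinct_list by blast
  then have "length cs = card P" using distinct_card by force
  then have len: "length cs \<le> length C" using card_mono[OF _ sub] by simp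
  let ?Fs = "map (\<lambda>c. (E c, \<lambda>_ :: nat \<Rightarrow> bool. c \<in> Q)) cs"
  have "\<exists>S'. grows S S' (Suc (length ?Fs)) \<and>
      node S' (VNode v w) (\<lambda>a. \<exists>(F, G)\<in>set ?Fs. F a \<and> G a)"
  proof (rule node_or[OF S])
    show "node S v F \<and> node S w G" if "(F, G) \<in> set ?Fs" for F G
    proof -
      from that obtain c where c: "c \<in> P" "F = E c" "G = (\<lambda>_. c \<in> Q)" using cs by auto
      show ?thesis using c cells const by (cases "c \<in> Q") auto
    qed
    show "\<exists>a. F a" if "(F, G) \<in> set ?Fs" for F G
      using that cs partitionsD(1)[OF P] proper_nontrivial by (auto simp: nontrivial_def)
    show "\<not> (fst (?Fs ! m) a \<and> fst (?Fs ! m') a)"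
      if "m < length ?Fs" "m' < length ?Fs" "m \<noteq> m'" for m m' a
      using that cs disjoint_gatesD[OF partitionsD(3)[OF P], of "cs ! m" "cs ! m'"]
      by (auto simp: nth_eq_iff_index_eq)
    show "\<exists>(F, G)\<in>set ?Fs. F a" for a
      using cs partitionsD(4)[OF P] by auto
  qed simp
  moreover have "(\<lambda>a. \<exists>(F, G)\<in>set ?Fs. F a \<and> G a) = (\<lambda>a. \<exists>c\<in>Q. E c a)"
    using cs Q by (auto intro!: ext)
  ultimately show ?thesis using len grows_le by fastforce
qed

text \<open>The cost is two constants at the auxiliary leaf and two unions of cells: over
  \<open>Q\<close> for \<open>u\<close>, over \<open>P - Q\<close> for its complement.\<close>

lemma provides_nonproper:
  assumes S: "wf_circ S" and u: "relevant u" "\<not> proper u"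
    and home: "home T (V u) = VNode l r" "\<not> (size l = 0 \<and> size r = 0)"
    and IH: "\<And>c. relevant c \<Longrightarrow> rank c < rank u \<Longrightarrow> provides M S c"
  shows "\<exists>S'. grows S S' (2 * length C + 4) \<and> provides M S' u"
proof -
  obtain P Q where P: "partitions (vvars (home T (V u))) P" "Q \<subseteq> P" "decomposes u Q"
    using u(1) by (auto simp: relevant_def)
  let ?v = "VNode (aug M l) (aug M r)" and ?w = "VLeaf (M + last (vleaves l))"
  have tgt: "target M u = VNode ?v ?w" using u(2) home by (auto simp: target_def)
  have cell: "node S ?v (E c)" if "c \<in> P" for c
  proof -
    note rel = relevant_cell[OF P(1) that]
    have c: "proper c" using partitionsD(1)[OF P(1) that] .
    have "rank c < rank u"
      using size_vsubtrees[OF rel(2)] c u(2) by (simp add: rank_def)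
    then have "node S (target M c) (E c)" using IH[OF rel(1)] by (simp add: provides_def)
    moreover have "target M c \<in> vsubtrees ?v"
    proof -
      \<comment> \<open>A cell with the same home as \<open>u\<close> sits exactly at
        \<open>?v\<close>; every other cell sits inside one of the two children of
        \<open>?v\<close>.\<close>
      consider "home T (V c) = VNode l r" | "home T (V c) \<in> vsubtrees l" | "home T (V c) \<in> vsubtrees r"
        using rel(2) home(1) by auto
      then show ?thesis
      proof cases
        case 1
        then show ?thesis using c by (simp add: target_def)
      next
        case 2
        then show ?thesis using vsubtrees_trans[OF target_vsubtrees aug_vsubtrees[OF 2]] by simp
      next
        case 3
        then show ?thesis using vsubtrees_trans[OF target_vsubtrees aug_vsubtrees[OF 3]] by simp
      qed
    qed
    ultimately show ?thesis by (rule node_mono)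
  qed
  obtain S1 where S1: "grows S S1 1" "node S1 ?w (\<lambda>_. True)" using node_const[OF S] by blast
  obtain S2 where S2: "grows S1 S2 1" "node S2 ?w (\<lambda>_. False)"
    using node_const[OF grows_wf[OF S1(1)]] by blast
  note const2 = node_grows[OF S1(2) S2(1)] S2(2)
  have cell2: "node S2 ?v (E c)" if "c \<in> P" for c
    using node_grows[OF node_grows[OF cell[OF that] S1(1)] S2(1)] .
  obtain S3 where S3: "grows S2 S3 (Suc (length C))" "node S3 (VNode ?v ?w) (\<lambda>a. \<exists>c\<in>Q. E c a)"
    using node_cells[OF grows_wf[OF S2(1)] P(1,2) cell2 const2] by blast
  have cell3: "node S3 ?v (E c)" if "c \<in> P" for c
    using node_grows[OF cell2[OF that] S3(1)] .
  obtain S4 where S4: "grows S3 S4 (Suc (length C))" "node S4 (VNode ?v ?w) (\<lambda>a. \<exists>c\<in>P - Q. E c a)"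
    using node_cells[OF grows_wf[OF S3(1)] P(1) Diff_subset cell3 const2[THEN node_grows[OF _ S3(1)]]]
    by blast
  have "(\<lambda>a. \<exists>c\<in>Q. E c a) = E u" using decomposesD(4)[OF P(3)] by (intro ext) simp
  moreover have "(\<exists>c\<in>P - Q. E c a) \<longleftrightarrow> \<not> E u a" for a
    using decomposesD(4)[OF P(3), of a] partitionsD(4)[OF P(1), of a] P(2)
      disjoint_gatesD[OF partitionsD(3)[OF P(1)], of _ _ a] by blast
  then have "(\<lambda>a. \<exists>c\<in>P - Q. E c a) = (\<lambda>a. \<not> E u a)" by (intro ext)
  ultimately have "provides M S4 u"
    using node_grows[OF S3(2) S4(1)] S4(2) unfolding provides_def tgt by simp
  moreover have "grows S S4 (2 * length C + 4)"
    using grows_trans[OF grows_trans[OF grows_trans[OF S1(1) S2(1)] S3(1)] S4(1)]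
    by (rule grows_le) simp
  ultimately show ?thesis by blast
qed

lemma provides_step:
  assumes S: "wf_circ S" and u: "relevant u"
    and IH: "\<And>c. relevant c \<Longrightarrow> rank c < rank u \<Longrightarrow> provides M S c"
  shows "\<exists>S'. grows S S' (2 * length C + 14) \<and> provides M S' u"
proof -
  have lt: "u < length C" using u nontrivial_length by (auto simp: relevant_def)
  consider (leaf) x where "home T (V u) = VLeaf x"
    | (two) x y where "home T (V u) = VNode (VLeaf x) (VLeaf y)"
    | (And) j k where "proper u" "C ! u = And j k"
    | (Lit) b x l r where "C ! u = Lit b x" "home T (V u) = VNode l r"
    | (big) l r where "\<not> proper u" "home T (V u) = VNode l r" "\<not> (size l = 0 \<and> size r = 0)"
  proof (cases "home T (V u)")
    case (VNode l r)
    show ?thesis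
    proof (cases "size l = 0 \<and> size r = 0")
      case True
      then show ?thesis using that(2) VNode by (auto simp: vtree_size_0)
    next
      case False
      then show ?thesis using that(3-5) VNode unfolding proper_def by blast
    qed
  qed (rule that(1))
  then have "\<exists>S' n. n \<le> 2 * length C + 14 \<and> grows S S' n \<and> provides M S' u"
  proof cases
    case leaf
    obtain S' where "grows S S' 2 \<and> provides M S' u" using provides_leaf[OF S lt leaf] by blast
    then show ?thesis by (intro exI[of _ S'] exI[of _ 2]) simp
  next
    case two
    obtain S' where "grows S S' 14 \<and> provides M S' u" using provides_two_leaves[OF S lt two] by blast
    then show ?thesis by (intro exI[of _ S'] exI[of _ 14]) simp
  next
    case And
    obtain S' where "grows S S' 8 \<and> provides M S' u" using provides_And[OF S u And IH] by blast
    then show ?thesis by (intro exI[of _ S'] exI[of _ 8]) simp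
  next
    case Lit
    \<comment> \<open>The home of a literal is a leaf, so this case is contradictory.\<close>
    then have "V u = {x}" using lt by (simp add: gvars_Lit)
    then show ?thesis using V_home[OF lt] home_minimal[OF Lit(2)] Lit(2) by auto
  next
    case big
    obtain S' where "grows S S' (2 * length C + 4) \<and> provides M S' u" using provides_nonproper[OF S u big IH] by blast
    then show ?thesis by (intro exI[of _ S'] exI[of _ "2 * length C + 4"]) simp
  qed
  then show ?thesis using grows_le by blast
qed

text \<open>Gates are processed by increasing rank. The leading 1 pays for an initial gate, since
  circuits are nonempty.\<close>

lemma provides_all:
  assumes "finite A" "A \<subseteq> {u. relevant u}"
    "\<And>u c. u \<in> A \<Longrightarrow> relevant c \<Longrightarrow> rank c < rank u \<Longrightarrow> c \<in> A"
  shows "\<exists>S. wf_circ S \<and> length S \<le> 1 + card A * (2 * length C + 14) \<and> (\<forall>u\<in>A. provides M S u)"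
  using assms
proof (induction A rule: finite_ranking_induct[where f = rank])
  case empty
  show ?case by (rule exI[of _ "[Const False]"]) (simp add: wf_circ_def)
next
  case (insert x A)
  show ?case
  proof (cases "x \<in> A")
    case True
    then have "insert x A = A" by blast
    then show ?thesis using insert.IH insert.prems by simp
  next
    case False
    \<comment> \<open>As \<open>x\<close> has maximal rank, \<open>A\<close> alone is still closed
      under relevant gates of smaller rank.\<close>
    have "\<And>u c. u \<in> A \<Longrightarrow> relevant c \<Longrightarrow> rank c < rank u \<Longrightarrow> c \<in> A"
      using insert.hyps(2) insert.prems(2) by (metis insertCI insertE leD)
    then obtain S where S: "wf_circ S" "length S \<le> 1 + card A * (2 * length C + 14)"
      "\<And>u. u \<in> A \<Longrightarrow> provides M S u"
      using insert.IH insert.prems(1) by auto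
    have "provides M S c" if "relevant c" "rank c < rank x" for c
      using S(3) insert.prems(2)[of x c] that by auto
    then obtain S' where S': "grows S S' (2 * length C + 14)" "provides M S' x"
      using provides_step[OF S(1), of x M] insert.prems(1) by auto
    have "\<forall>u\<in>insert x A. provides M S' u" using S' S(3) provides_grows by blast
    moreover have "length S' \<le> 1 + card (insert x A) * (2 * length C + 14)"
      using S' S(2) insert.hyps(1) False by (simp add: grows_def)
    ultimately show ?thesis using grows_wf[OF S'(1)] by blast
  qed
qed

text \<open>The 2 consists of the initial gate and the copy appended as output.\<close>

lemma sdd_exists:
  assumes "relevant u"
  shows "\<exists>S. is_SDD (aug M T) S \<and> represents S (E u) \<and>
    length S \<le> 2 + length C * (2 * length C + 14)"
proof -
  let ?A = "{u. relevant u}"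
  have sub: "?A \<subseteq> {..<length C}" using nontrivial_length by (auto simp: relevant_def)
  then have fin: "finite ?A" and card: "card ?A \<le> length C"
    using finite_subset card_mono[OF _ sub] by auto
  obtain S where S: "wf_circ S" "length S \<le> 1 + card ?A * (2 * length C + 14)" "provides M S u"
    using provides_all[OF fin, of M] assms by auto
  have "node S (aug M T) (E u)"
    using S(3) node_mono vsubtrees_trans[OF target_vsubtrees aug_vsubtrees[OF home_vsubtrees]]
    unfolding provides_def by blast
  then obtain S' where "is_SDD (aug M T) S'" "represents S' (E u)" "length S' = Suc (length S)"
    using node_output[OF S(1)] by blast
  moreover have "card ?A * (2 * length C + 14) \<le> length C * (2 * length C + 14)"
    using card by (rule mult_le_mono1)
  ultimately show ?thesis using S(2) by (intro exI[of _ S']) linarith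
qed

end

section \<open>Joining the two given circuits and concluding\<close>

lemma structured_circuit_juxtapose:
  assumes A: "structured_dDNNF X T A" and B: "structured_dDNNF X T B"
  shows "structured_circuit (juxtapose A B) T"
proof -
  have dist: "distinct (vleaves T)" and X: "vvars T = X"
    using A by (auto simp: structured_dDNNF_def vtree_for_def vvars_def)
  have A': "nnf_on X A" "wf_circ A" "deterministic A"
    and B': "nnf_on X B" "wf_circ B" "deterministic B"
    using A B by (auto simp: structured_dDNNF_def d_DNNF_def nnf_on_def)
  note J = juxtapose_left[of _ A B] juxtapose_right[OF A'(2) B'(2)]
  \<comment> \<open>A gate and its children lie in the same part, so determinism and structure are
    inherited from that part.\<close>
  have gate_cases: thesis
    if "i < length (juxtapose A B)"
      "i < length A \<Longrightarrow> thesis" "\<And>m. i = length A + m \<Longrightarrow> m < length B \<Longrightarrow> thesis" for i thesis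
    using that by (metis add_less_cancel_left le_Suc_ex length_juxtapose not_less)
  show ?thesis
  proof
    show "wf_circ (juxtapose A B)" using A'(2) B'(2) by (rule wf_juxtapose)
    show "distinct (vleaves T)" by (rule dist)
    show "gvars (juxtapose A B) i \<subseteq> vvars T" if "i < length (juxtapose A B)" for i
      using that by (rule gate_cases) (use gvars_subset A'(1) B'(1) X in \<open>simp_all add: J\<close>)
    show "deterministic (juxtapose A B)"
      unfolding deterministic_def
    proof (intro allI impI ballI)
      fix i js j k
      assume i: "i < length (juxtapose A B)" and js: "juxtapose A B ! i = Or js"
        and jk: "j \<in> set js" "k \<in> set js" "j \<noteq> k"
      show "\<not> (\<exists>a. ev (juxtapose A B) a j \<and> ev (juxtapose A B) a k)"
        using i
      proof (rule gate_cases)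
        assume lt: "i < length A"
        then have Or: "A ! i = Or js" using js by (simp add: nth_juxtapose)
        have "j < length A" "k < length A" using wf_Or(2)[OF A'(2) lt Or] jk lt by fastforce+
        then show ?thesis using A'(3) lt Or jk unfolding deterministic_def by (simp add: J)
      next
        fix m assume m: "i = length A + m" "m < length B"
        then obtain js' where Or: "B ! m = Or js'" "js = map ((+) (length A)) js'"
          using js by (cases "B ! m") (auto simp: nth_juxtapose)
        then obtain j' k' where jk': "j = length A + j'" "k = length A + k'" "j' \<in> set js'" "k' \<in> set js'"
          using jk by auto
        have "j' < length B" "k' < length B" using wf_Or(2)[OF B'(2) m(2) Or(1)] jk' m(2) by fastforce+
        then show ?thesis using B'(3) m(2) Or(1) jk jk' unfolding deterministic_def by (simp add: J)
      qed
    qed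
    show "\<exists>v\<in>vsubtrees T. respects_node (juxtapose A B) j k v"
      if i: "i < length (juxtapose A B)" and And: "juxtapose A B ! i = And j k" for i j k
      using i
    proof (rule gate_cases)
      assume lt: "i < length A"
      then have Ai: "A ! i = And j k" using And by (simp add: nth_juxtapose)
      have "j < length A" "k < length A" using wf_And[OF A'(2) lt Ai] lt by simp_all
      then show ?thesis using A lt Ai unfolding structured_dDNNF_def respects_node_def
        by (simp add: J)
    next
      fix m assume m: "i = length A + m" "m < length B"
      then obtain j' k' where Bm: "B ! m = And j' k'" "j = length A + j'" "k = length A + k'"
        using And by (cases "B ! m") (auto simp: nth_juxtapose)
      have "j' < length B" "k' < length B" using wf_And[OF B'(2) m(2) Bm(1)] m(2) by simp_all
      then show ?thesis using B m Bm unfolding structured_dDNNF_def respects_node_def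
        by (simp add: J)
    qed
  qed
qed

theorem mainTheorem4:
  "\<exists>c::nat. \<forall>(X::nat set) (f::(nat \<Rightarrow> bool) \<Rightarrow> bool) (D::gate list) (Dn::gate list) (T::vtree).
     finite X \<and>
     (\<forall>a b. (\<forall>x\<in>X. a x = b x) \<longrightarrow> f a = f b) \<and>
     normalized T \<and>
     structured_dDNNF X T D \<and> smooth D \<and> simple D \<and> represents D f \<and>
     structured_dDNNF X T Dn \<and> smooth Dn \<and> simple Dn \<and> represents Dn (\<lambda>a. \<not> f a)
     \<longrightarrow> (\<exists>(T'::vtree) (H::nat set) (S::gate list).
            finite H \<and> H \<inter> X = {} \<and> card H \<le> card X - 2 \<and>
            vtree_for T' (X \<union> H) \<and>
            is_SDD T' S \<and> represents S f \<and>
            length S \<le> c * (length D + length Dn)\<^sup>2)"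
proof (rule exI[of _ 18], intro allI impI, elim conjE)
  fix X :: "nat set" and f D Dn T
  assume fin: "finite X"
    and D: "structured_dDNNF X T D" "represents D f"
    and Dn: "structured_dDNNF X T Dn" "represents Dn (\<lambda>a. \<not> f a)"
  define C where "C = juxtapose D Dn"
  interpret structured_circuit C T
    unfolding C_def using D(1) Dn(1) by (rule structured_circuit_juxtapose)
  have T: "distinct (vleaves T)" "vvars T = X"
    using D(1) by (auto simp: structured_dDNNF_def vtree_for_def vvars_def)
  have wfs: "wf_circ D" "wf_circ Dn" "D \<noteq> []" "Dn \<noteq> []"
    using D(1) Dn(1) by (auto simp: structured_dDNNF_def d_DNNF_def nnf_on_def wf_circ_def)
  define N where "N = length D + length Dn"
  have N: "length C = N" by (simp add: C_def N_def)
  have "1 \<le> N" using wfs by (cases D) (auto simp: N_def)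
  then have N2: "1 \<le> N\<^sup>2" "N \<le> N\<^sup>2" by (simp_all add: power2_eq_square)
  define u where "u = out D"
  define u' where "u' = length D + out Dn"
  have lt: "u < length C" "u' < length C" using wfs
    by (cases D; cases Dn; simp add: N N_def u_def u'_def out_def)+
  have f: "E u a = f a" "E u' a = (\<not> f a)" for a
    using D(2) Dn(2) wfs by (simp_all add: C_def u_def u'_def represents_def out_def
        juxtapose_left juxtapose_right)
  define M where "M = Suc (Max X)"
  have M: "x < M" if "x \<in> X" for x using that fin by (simp add: M_def less_Suc_eq_le)
  define H where "H = set (aux_leaves M T)"
  have "card H \<le> size T - 1"
    unfolding H_def using card_length length_aux_leaves le_trans by blast
  moreover have "card X = Suc (size T)"
    using T distinct_card length_vleaves unfolding vvars_def by metis
  ultimately have "card H \<le> card X - 2" by simp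
  moreover have "H \<inter> X = {}"
    using aux_leaves_subset[of M T] M unfolding H_def by fastforce
  moreover have "vtree_for (aug M T) (X \<union> H)"
    using distinct_vleaves_aug[OF T(1), of M] M T(2) vvars_aug[of M T]
    by (simp add: vtree_for_def H_def vvars_def)
  moreover have "\<exists>S. is_SDD (aug M T) S \<and> represents S f \<and> length S \<le> 18 * N\<^sup>2"
  proof (cases "\<exists>b. \<forall>a. f a = b")
    case True
    \<comment> \<open>For constant \<open>f\<close> the output gates have no decomposition to start
      from; a single constant gate suffices.\<close>
    then obtain b where b: "\<And>a. f a = b" by blast
    have "sdd [Const b] (aug M T) 0" by (rule sdd_const) simp_all
    then have "is_SDD (aug M T) [Const b]" by (simp add: is_SDD_def wf_circ_def out_def)
    moreover have "represents [Const b] f" using b by (simp add: represents_def out_def ev_Const)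
    ultimately show ?thesis using N2 by (intro exI[of _ "[Const b]"]) simp
  next
    case False
    then have "\<exists>a. f a" "\<exists>a. \<not> f a" by metis+
    then have nt: "nontrivial u" "nontrivial u'" using lt f by (simp_all add: nontrivial_def)
    note Q = decomposes_cells[OF nt(1)] and Q' = decomposes_cells[OF nt(2)]
    \<comment> \<open>A cell of one output implies \<open>f\<close>, a cell of the other implies its
      negation. Together they partition the assignments at the root, which starts the
      descent.\<close>
    have ne: "\<not> (E c a \<and> E c' a)" if "c \<in> cells u" "c' \<in> cells u'" for c c' a
      using that decomposesD(4)[OF Q, of a] decomposesD(4)[OF Q', of a] f[of a] by blast
    then have "disjoint_gates (cells u \<union> cells u')"
      using decomposesD(3)[OF Q] decomposesD(3)[OF Q'] unfolding disjoint_gates_def by blast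
    moreover have "\<exists>c\<in>cells u \<union> cells u'. E c a" for a
      using decomposesD(4)[OF Q, of a] decomposesD(4)[OF Q', of a] f[of a] by blast
    ultimately have P: "partitions (vvars T) (cells u \<union> cells u')"
      using decomposesD(1,2)[OF Q] decomposesD(1,2)[OF Q'] vars_T[OF lt(1)] vars_T[OF lt(2)]
      unfolding partitions_def by blast
    have "relevant u"
      using vars_T[OF lt(1)] by (intro relevantI[OF vsubtrees_refl P _ Q nt(1)]) auto
    then obtain S where S: "is_SDD (aug M T) S" "represents S (E u)" "length S \<le> 2 + N * (2 * N + 14)"
      using sdd_exists[of u M] unfolding N by blast
    \<comment> \<open>The constant 18 is \<open>2 + 2 + 14\<close>, because both 1 and
      \<open>N\<close> are at most \<open>N\<^sup>2\<close>.\<close>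
    have "N * (2 * N + 14) = 2 * N\<^sup>2 + 14 * N" by (simp add: power2_eq_square algebra_simps)
    then have "2 + N * (2 * N + 14) \<le> 18 * N\<^sup>2" using N2 by linarith
    then show ?thesis using S f by (intro exI[of _ S]) (simp add: represents_def)
  qed
  moreover have "finite H" by (simp add: H_def)
  ultimately show "\<exists>(T'::vtree) (H::nat set) (S::gate list).
            finite H \<and> H \<inter> X = {} \<and> card H \<le> card X - 2 \<and>
            vtree_for T' (X \<union> H) \<and>
            is_SDD T' S \<and> represents S f \<and>
            length S \<le> 18 * (length D + length Dn)\<^sup>2"
    unfolding N_def by blast
qed

end
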